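(* Let $n\ge 2$. There exists a constant $\tau_n>0$ depending only on $n$ with the following property. Let $\Omega\subset\mathbb{R}^n$ be a bounded domain with $0\in\partial\Omega$ satisfying the exterior ball condition $B_\rho(-\rho e_n)\subset\mathbb{R}^n\setminus\overline{\Omega}$ for some $\rho>0$, and let $D=\sup_{x\in\Omega}|x|$. If $\rho\ge D/\tau_n$, then $$\int_\Omega|\nabla u|^2dx\ \ge\ \frac{n^2}{4}\int_\Omega\frac{u^2}{|x|^2}dx\qquad\text{for all }u\in C_c^\infty(\Omega).$$ If in addition $\Omega$ satisfies an interior ball condition at $0$, then the constant $n^2/4$ is sharp, i.e. it cannot be replaced by any larger constant.
   Context: $B_r(x_0)$ is the open ball of radius $r$ centered at $x_0$; $e_n$ is the unit vector in the $x_n$ direction. Interior ball condition at $0$: there exists an open ball $B\subset\Omega$ with $0\in\partial B$. *)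

theory Defs
  imports "HOL-Analysis.Analysis"
begin

definition partial_deriv :: "'n::finite \<Rightarrow> (real ^ 'n \<Rightarrow> real) \<Rightarrow> real ^ 'n \<Rightarrow> real" where
  "partial_deriv i f x = frechet_derivative f (at x) (axis i 1)"

definition gradient :: "(real ^ 'n::finite \<Rightarrow> real) \<Rightarrow> real ^ 'n \<Rightarrow> real ^ 'n" where
  "gradient f x = (\<chi> i. partial_deriv i f x)"

primrec C_k :: "nat \<Rightarrow> (real ^ 'n::finite \<Rightarrow> real) \<Rightarrow> bool" where
  "C_k 0 f \<longleftrightarrow> continuous_on UNIV f"
| "C_k (Suc k) f \<longleftrightarrow> f differentiable_on UNIV \<and> (\<forall>i. C_k k (partial_deriv i f))"

(* Elements of C_c^infinity(Omega) are represented by their extension by zero to the whole space. *)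
definition test_functions :: "(real ^ 'n::finite) set \<Rightarrow> (real ^ 'n \<Rightarrow> real) set" where
  "test_functions \<Omega> =
     {u. (\<forall>k. C_k k u) \<and> compact (closure {x. u x \<noteq> 0}) \<and> closure {x. u x \<noteq> 0} \<subseteq> \<Omega>}"

definition domain :: "(real ^ 'n::finite) set \<Rightarrow> bool" where
  "domain \<Omega> \<longleftrightarrow> open \<Omega> \<and> connected \<Omega> \<and> \<Omega> \<noteq> {}"

definition interior_ball_condition :: "(real ^ 'n::finite) set \<Rightarrow> real ^ 'n \<Rightarrow> bool" where
  "interior_ball_condition \<Omega> p \<longleftrightarrow> (\<exists>c r. r > 0 \<and> ball c r \<subseteq> \<Omega> \<and> p \<in> frontier (ball c r))"

definition hardy_inequality :: "(real ^ 'n::finite) set \<Rightarrow> real \<Rightarrow> bool" where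
  "hardy_inequality \<Omega> C \<longleftrightarrow>
     (\<forall>u \<in> test_functions \<Omega>.
        (LINT x:\<Omega>|lebesgue. (norm (gradient u x))\<^sup>2)
          \<ge> C * (LINT x:\<Omega>|lebesgue. (u x)\<^sup>2 / (norm x)\<^sup>2))"

end

theory Submission
  imports Defs
begin

text \<open>
  Write \<open>n\<close> for the dimension and \<open>r = |x|\<close>.

  \<^emph>\<open>The inequality.\<close> By Barta's method, a positive \<open>\<phi>\<close> with
  \<open>- \<Delta> \<phi> \<ge> (n\<^sup>2/4) \<phi> / r\<^sup>2\<close> on the domain suffices: integrate the divergence of
  \<open>u\<^sup>2 \<nabla>\<phi> / \<phi>\<close>, which has compact support, and complete a square
  (\<open>hardy_inequality_of_supersolution\<close>). On the half space \<open>x \<bullet> e > 0\<close> the function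
  \<open>(x \<bullet> e) r\<^bsup>-n/2\<^esup>\<close> solves the equation with equality. For a domain outside the ball of
  radius \<open>\<rho>\<close> centred at \<open>- \<rho> e\<close>, with \<open>\<kappa> = 1/(2\<rho>)\<close>, the quadratic
  \<open>w = x \<bullet> e + \<kappa> r\<^sup>2\<close> is positive on the domain and vanishes on the sphere, so
  \<open>w r\<^bsup>-n/2\<^esup>\<close> is the natural candidate. It fails by a term of size \<open>n \<kappa> r\<^bsup>-n/2\<^esup>\<close>,
  which does not vanish where \<open>w\<close> does. The correction \<open>- (n/2) \<kappa> w\<^sup>2 r\<^bsup>-n/2\<^esup>\<close> cancels this
  term, because \<open>\<Delta>(w\<^sup>2)\<close> is close to 2 near \<open>w = 0\<close>, and leaves an error proportional to
  \<open>w\<^sup>2\<close>. That error is absorbed by the correction \<open>- n\<^sup>2 \<kappa> w r\<^bsup>1-n/2\<^esup>\<close>, whose exponent is no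
  longer critical. The sum stays positive while \<open>\<kappa> r (n\<^sup>2 + n) < 1\<close>; this is where the
  constant \<open>\<tau> = 1/(n\<^sup>2 + n + 1)\<close> comes from (\<open>exterior_ball_supersolution\<close>).

  \<^emph>\<open>Sharpness.\<close> Let \<open>\<nu>\<close> be the direction of the centre of the interior ball. A compact
  subset of the half space \<open>x \<bullet> \<nu> > 0\<close> is mapped into that ball by every sufficiently
  strong contraction, and the quotient of the two integrals is invariant under dilations.
  So it suffices to bring the quotient close to \<open>n\<^sup>2/4\<close> with smooth functions compactly
  supported in the half space. The trial functions are
  \<open>p (x \<bullet> \<nu>) r\<^bsup>-n/2\<^esup> \<zeta> (\<epsilon> ln r)\<close> with a smooth bump \<open>\<zeta>\<close> and a smooth approximation
  \<open>p\<close> of the positive part. When \<open>p\<close> tends to the positive part, both integrals converge to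
  integrals against the density \<open>((x \<bullet> \<nu>)\<^sup>+)\<^sup>2 r\<^bsup>-n-2\<^esup>\<close> (\<open>trial_integrals_limits\<close>). The
  measure with this density is invariant under dilations, so annuli of equal logarithmic width have equal mass,
  and derivatives of \<open>\<zeta> (\<epsilon> ln r)\<close> contribute only a fraction of order \<open>\<epsilon>\<close>
  (\<open>almost_critical_profile\<close>).
\<close>

section \<open>Integrals of compactly supported functions and their derivatives\<close>

lemma integrable_continuous_compact_support:
  fixes f :: "'a::euclidean_space \<Rightarrow> real"
  assumes "continuous_on UNIV f" "compact K" "\<And>x. x \<notin> K \<Longrightarrow> f x = 0"
  shows "integrable lborel f"
proof -
  have "(\<lambda>x. indicator K x *\<^sub>R f x) = f"
    using assms(3) by (force simp: indicator_def)
  then show ?thesis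
    using borel_integrable_compact[OF assms(2), of f] continuous_on_subset[OF assms(1)] by auto
qed

lemma bounded_continuous_compact_support:
  fixes f :: "'a::euclidean_space \<Rightarrow> real"
  assumes "continuous_on UNIV f" "compact K" "\<And>x. x \<notin> K \<Longrightarrow> f x = 0"
  obtains M where "M > 0" "\<And>x. \<bar>f x\<bar> \<le> M"
proof -
  have "bounded (f ` K)"
    using assms by (meson compact_continuous_image compact_imp_bounded continuous_on_subset top_greatest)
  then obtain M where "M > 0" "\<And>x. x \<in> K \<Longrightarrow> \<bar>f x\<bar> \<le> M"
    by (auto simp: bounded_pos)
  with assms(3) that[of M] show thesis by (metis abs_zero less_imp_le)
qed

text \<open>
  The functions integrated below contain factors like \<open>1 / |x|\<^sup>2\<close> or \<open>1 / \<phi>\<close> that are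
  continuous only on an open set \<open>U\<close>, but another factor vanishes off a compact subset of it.
\<close>

lemma continuous_on_zero_off_compact:
  fixes f :: "'a::t2_space \<Rightarrow> 'b::real_normed_vector"
  assumes "continuous_on U f" "open U" "compact K" "K \<subseteq> U" "\<And>x. x \<notin> K \<Longrightarrow> f x = 0"
  shows "continuous_on UNIV f"
proof -
  have "continuous_on (- K) f"
    using assms(5) by (subst continuous_on_cong[where g="\<lambda>_. 0"]) auto
  then have "continuous_on (U \<union> - K) f"
    using assms by (intro continuous_on_open_Un) (auto simp: compact_imp_closed)
  moreover have "U \<union> - K = UNIV" using assms(4) by auto
  ultimately show ?thesis by simp
qed

lemma integral_translation_lborel:
  fixes f :: "'a::euclidean_space \<Rightarrow> real"
  assumes "f \<in> borel_measurable borel"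
  shows "(\<integral>x. f (c + x) \<partial>lborel) = (\<integral>x. f x \<partial>lborel)"
proof -
  have "(\<integral>x. f x \<partial>lborel) = (\<integral>x. f x \<partial>distr lborel borel ((+) c))"
    by (simp add: lborel_distr_plus)
  also have "\<dots> = (\<integral>x. f (c + x) \<partial>lborel)"
    using assms by (subst integral_distr) auto
  finally show ?thesis by simp
qed

lemma integrable_translation_lborel:
  fixes f :: "'a::euclidean_space \<Rightarrow> real"
  assumes "integrable lborel f"
  shows "integrable lborel (\<lambda>x. f (c + x))"
proof -
  have "integrable (distr lborel borel ((+) c)) f"
    using assms by (simp add: lborel_distr_plus)
  then show ?thesis
    by (subst (asm) integrable_distr_eq) (use assms in auto)
qed

lemma integral_dilation_lborel:
  fixes f :: "'a::euclidean_space \<Rightarrow> real"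
  assumes "f \<in> borel_measurable borel" "c > 0"
  shows "c ^ DIM('a) * (\<integral>x. f (c *\<^sub>R x) \<partial>lborel) = (\<integral>x. f x \<partial>lborel)"
proof -
  have "(\<integral>x. f x \<partial>lborel) =
      (\<integral>x. f x \<partial>density (distr lborel borel (\<lambda>x. 0 + c *\<^sub>R x)) (\<lambda>_. ennreal (\<bar>c\<bar> ^ DIM('a))))"
    using lborel_affine[of c "0::'a"] assms(2) by simp
  also have "\<dots> = (\<integral>x. c ^ DIM('a) * f x \<partial>distr lborel borel (\<lambda>x. c *\<^sub>R x))"
    using assms by (subst integral_real_density) auto
  also have "\<dots> = c ^ DIM('a) * (\<integral>x. f (c *\<^sub>R x) \<partial>lborel)"
    using assms by (subst integral_distr) auto
  finally show ?thesis by simp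
qed

text \<open>
  The translates of \<open>g\<close> in the direction \<open>v\<close> all have the same integral, so the integral of
  each difference quotient is 0. The quotients converge to \<open>d\<close>, and the mean value theorem
  bounds them by the supremum of \<open>d\<close> on a fixed ball, which permits the passage to the limit.
  This is the only form of integration by parts used in this theory.
\<close>

lemma integral_directional_derivative_eq_0:
  fixes g d :: "'a::euclidean_space \<Rightarrow> real"
  assumes g: "continuous_on UNIV g" and d: "continuous_on UNIV d"
    and deriv: "\<And>x. ((\<lambda>t. g (x + t *\<^sub>R v)) has_real_derivative d x) (at 0)"
    and K: "compact K" and gK: "\<And>x. x \<notin> K \<Longrightarrow> g x = 0" and dK: "\<And>x. x \<notin> K \<Longrightarrow> d x = 0"
  shows "(\<integral>x. d x \<partial>lborel) = 0"
proof -
  obtain M where M: "M > 0" "\<And>x. \<bar>d x\<bar> \<le> M"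
    using bounded_continuous_compact_support[OF d K dK] by blast
  obtain R where R: "K \<subseteq> cball 0 R"
    using compact_imp_bounded[OF K] by (force simp: bounded_iff)
  let ?B = "cball 0 (R + norm v) :: 'a set"
  define h where "h j = inverse (real (Suc j))" for j
  have h: "0 < h j" "h j \<le> 1" for j
    unfolding h_def by (auto simp: field_simps)
  define s where "s j x = (g (x + h j *\<^sub>R v) - g x) / h j" for j x
  have gm: "g \<in> borel_measurable borel"
    by (rule borel_measurable_continuous_onI[OF g])
  have gi: "integrable lborel g"
    by (rule integrable_continuous_compact_support[OF g K gK])
  have line: "((\<lambda>t. g (x + t *\<^sub>R v)) has_real_derivative d (x + t0 *\<^sub>R v)) (at t0)" for x t0
  proof -
    have "((\<lambda>t. g ((x + t0 *\<^sub>R v) + (t - t0) *\<^sub>R v)) has_real_derivative d (x + t0 *\<^sub>R v) * 1) (at t0)"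
      by (rule DERIV_chain'[where f="\<lambda>t. t - t0" and g="\<lambda>t. g ((x + t0 *\<^sub>R v) + t *\<^sub>R v)"])
         (use deriv[of "x + t0 *\<^sub>R v"] in \<open>auto intro!: derivative_eq_intros\<close>)
    then show ?thesis by (simp add: algebra_simps)
  qed
  have bound: "\<bar>s j x\<bar> \<le> indicator ?B x *\<^sub>R M" for j x
  proof (cases "x \<in> ?B")
    case True
    obtain z where "g (x + h j *\<^sub>R v) - g (x + 0 *\<^sub>R v) = (h j - 0) * d (x + z *\<^sub>R v)"
      using MVT2[OF h(1)[of j], where f="\<lambda>t. g (x + t *\<^sub>R v)" and f'="\<lambda>t. d (x + t *\<^sub>R v)"] line by blast
    then have "s j x = d (x + z *\<^sub>R v)"
      using h[of j] by (simp add: s_def)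
    then show ?thesis using True M(2) by simp
  next
    case False
    then have "x \<notin> K" using R by (auto simp: subset_iff) (metis add_increasing2 norm_ge_zero)
    moreover have "x + h j *\<^sub>R v \<notin> K"
    proof
      assume "x + h j *\<^sub>R v \<in> K"
      then have "norm (x + h j *\<^sub>R v) \<le> R" using R by auto
      moreover have "norm (h j *\<^sub>R v) \<le> norm v"
        using h[of j] by (simp add: mult_left_le_one_le)
      ultimately have "norm x \<le> R + norm v"
        using norm_triangle_ineq4[of "x + h j *\<^sub>R v" "h j *\<^sub>R v"] by simp
      with False show False by simp
    qed
    ultimately show ?thesis using False gK by (simp add: s_def)
  qed
  have "(\<lambda>j. \<integral>x. s j x \<partial>lborel) \<longlonglongrightarrow> (\<integral>x. d x \<partial>lborel)"
  proof (rule integral_dominated_convergence[where w="\<lambda>x. indicator ?B x *\<^sub>R M"])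
    show "d \<in> borel_measurable lborel"
      using borel_measurable_continuous_onI[OF d] by simp
    show "s j \<in> borel_measurable lborel" for j
      unfolding s_def using gm by measurable
    show "integrable lborel (\<lambda>x. indicator ?B x *\<^sub>R M)"
      by (rule borel_integrable_compact) auto
    show "AE x in lborel. norm (s j x) \<le> indicator ?B x *\<^sub>R M" for j
      using bound by auto
    have "(\<lambda>j. s j x) \<longlonglongrightarrow> d x" for x
    proof -
      have "((\<lambda>t. (g (x + t *\<^sub>R v) - g x) / t) \<longlongrightarrow> d x) (at 0)"
        using deriv[of x] by (simp add: has_field_derivative_iff)
      moreover have "filterlim h (at 0) sequentially"
        unfolding filterlim_at h_def using LIMSEQ_inverse_real_of_nat by (auto intro!: always_eventually)
      ultimately show ?thesis
        unfolding s_def by (rule filterlim_compose)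
    qed
    then show "AE x in lborel. (\<lambda>j. s j x) \<longlonglongrightarrow> d x" by auto
  qed
  moreover have "(\<integral>x. s j x \<partial>lborel) = 0" for j
  proof -
    have "(\<integral>x. g (x + h j *\<^sub>R v) \<partial>lborel) = (\<integral>x. g x \<partial>lborel)"
      using integral_translation_lborel[OF gm, of "h j *\<^sub>R v"] by (simp add: add.commute)
    moreover have "integrable lborel (\<lambda>x. g (x + h j *\<^sub>R v))"
      using integrable_translation_lborel[OF gi, of "h j *\<^sub>R v"] by (simp add: add.commute)
    ultimately show ?thesis
      unfolding s_def using gi by simp
  qed
  ultimately show ?thesis using LIMSEQ_unique[of "\<lambda>_. 0::real" 0] by simp
qed

section \<open>Functions with a Laplacian, and Hardy inequalities from supersolutions\<close>

text \<open>
  \<open>g\<close> is the gradient and \<open>l\<close> the Laplacian of \<open>f\<close> on \<open>U\<close>, written as the trace of the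
  derivative of \<open>g\<close>. Continuity is required of the diagonal second derivatives separately,
  since integration by parts is carried out one coordinate direction at a time.
\<close>

definition has_laplacian_on ::
    "('a::euclidean_space \<Rightarrow> real) \<Rightarrow> ('a \<Rightarrow> 'a) \<Rightarrow> ('a \<Rightarrow> real) \<Rightarrow> 'a set \<Rightarrow> bool" where
  "has_laplacian_on f g l U \<longleftrightarrow>
     (\<forall>x\<in>U. (f has_derivative (\<lambda>v. g x \<bullet> v)) (at x)) \<and>
     (\<exists>A. (\<forall>x\<in>U. (g has_derivative A x) (at x) \<and> (\<Sum>b\<in>Basis. A x b \<bullet> b) = l x) \<and>
          (\<forall>b\<in>Basis. continuous_on U (\<lambda>x. A x b \<bullet> b)))"

lemma has_laplacian_on_continuous:
  assumes "has_laplacian_on f g l U"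
  shows "continuous_on U f" "continuous_on U g"
proof -
  obtain A where "\<And>x. x \<in> U \<Longrightarrow> (f has_derivative (\<lambda>v. g x \<bullet> v)) (at x)"
      "\<And>x. x \<in> U \<Longrightarrow> (g has_derivative A x) (at x)"
    using assms unfolding has_laplacian_on_def by blast
  then show "continuous_on U f" "continuous_on U g"
    by (auto intro!: continuous_at_imp_continuous_on has_derivative_continuous)
qed

lemma has_laplacian_on_const: "has_laplacian_on (\<lambda>_. c) (\<lambda>_. 0) (\<lambda>_. 0) U"
  unfolding has_laplacian_on_def
proof (intro conjI exI[of _ "\<lambda>_ _. 0"] ballI)
  show "((\<lambda>_. c) has_derivative (\<lambda>v. 0 \<bullet> v)) (at x)" for x :: 'a
    by simp
qed auto

lemma has_laplacian_on_add:
  assumes "has_laplacian_on f1 g1 l1 U" "has_laplacian_on f2 g2 l2 U"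
  shows "has_laplacian_on (\<lambda>x. f1 x + f2 x) (\<lambda>x. g1 x + g2 x) (\<lambda>x. l1 x + l2 x) U"
proof -
  obtain A1 A2 where A:
    "\<forall>x\<in>U. (g1 has_derivative A1 x) (at x) \<and> (\<Sum>b\<in>Basis. A1 x b \<bullet> b) = l1 x"
    "\<forall>b\<in>Basis. continuous_on U (\<lambda>x. A1 x b \<bullet> b)"
    "\<forall>x\<in>U. (g2 has_derivative A2 x) (at x) \<and> (\<Sum>b\<in>Basis. A2 x b \<bullet> b) = l2 x"
    "\<forall>b\<in>Basis. continuous_on U (\<lambda>x. A2 x b \<bullet> b)"
    using assms unfolding has_laplacian_on_def by blast
  show ?thesis unfolding has_laplacian_on_def
  proof (intro conjI exI[of _ "\<lambda>x v. A1 x v + A2 x v"] ballI)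
    fix x assume "x \<in> U"
    show "((\<lambda>x. f1 x + f2 x) has_derivative (\<lambda>v. (g1 x + g2 x) \<bullet> v)) (at x)"
      using assms \<open>x \<in> U\<close> unfolding has_laplacian_on_def
      by (auto simp: inner_add_left intro!: has_derivative_add)
    show "((\<lambda>x. g1 x + g2 x) has_derivative (\<lambda>v. A1 x v + A2 x v)) (at x)"
      using A \<open>x \<in> U\<close> by (auto intro!: has_derivative_add)
    show "(\<Sum>b\<in>Basis. (A1 x b + A2 x b) \<bullet> b) = l1 x + l2 x"
      using A \<open>x \<in> U\<close> by (simp add: inner_add_left sum.distrib)
  next
    fix b :: 'a assume "b \<in> Basis"
    then show "continuous_on U (\<lambda>x. (A1 x b + A2 x b) \<bullet> b)"
      using A by (auto simp: inner_add_left intro!: continuous_on_add)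
  qed
qed

lemma has_laplacian_on_mult:
  fixes f1 f2 :: "'a::euclidean_space \<Rightarrow> real"
  assumes "has_laplacian_on f1 g1 l1 U" "has_laplacian_on f2 g2 l2 U"
  shows "has_laplacian_on (\<lambda>x. f1 x * f2 x) (\<lambda>x. f1 x *\<^sub>R g2 x + f2 x *\<^sub>R g1 x)
           (\<lambda>x. f1 x * l2 x + 2 * (g1 x \<bullet> g2 x) + f2 x * l1 x) U"
proof -
  obtain A1 A2 where A:
    "\<forall>x\<in>U. (g1 has_derivative A1 x) (at x) \<and> (\<Sum>b\<in>Basis. A1 x b \<bullet> b) = l1 x"
    "\<forall>b\<in>Basis. continuous_on U (\<lambda>x. A1 x b \<bullet> b)"
    "\<forall>x\<in>U. (g2 has_derivative A2 x) (at x) \<and> (\<Sum>b\<in>Basis. A2 x b \<bullet> b) = l2 x"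
    "\<forall>b\<in>Basis. continuous_on U (\<lambda>x. A2 x b \<bullet> b)"
    using assms unfolding has_laplacian_on_def by blast
  let ?A = "\<lambda>x v. (f1 x *\<^sub>R A2 x v + (g1 x \<bullet> v) *\<^sub>R g2 x) + (f2 x *\<^sub>R A1 x v + (g2 x \<bullet> v) *\<^sub>R g1 x)"
  have D: "\<And>x. x \<in> U \<Longrightarrow> (f1 has_derivative (\<lambda>v. g1 x \<bullet> v)) (at x)"
    "\<And>x. x \<in> U \<Longrightarrow> (f2 has_derivative (\<lambda>v. g2 x \<bullet> v)) (at x)"
    using assms unfolding has_laplacian_on_def by auto
  note cont = has_laplacian_on_continuous[OF assms(1)] has_laplacian_on_continuous[OF assms(2)]
  show ?thesis unfolding has_laplacian_on_def
  proof (intro conjI exI[of _ ?A] ballI)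
    fix x assume x: "x \<in> U"
    show "((\<lambda>x. f1 x * f2 x) has_derivative (\<lambda>v. (f1 x *\<^sub>R g2 x + f2 x *\<^sub>R g1 x) \<bullet> v)) (at x)"
      by (rule has_derivative_eq_rhs[OF has_derivative_mult[OF D(1)[OF x] D(2)[OF x]]])
         (auto simp: algebra_simps)
    have d2: "(g2 has_derivative A2 x) (at x)" and d1: "(g1 has_derivative A1 x) (at x)"
      using A x by auto
    show "((\<lambda>x. f1 x *\<^sub>R g2 x + f2 x *\<^sub>R g1 x) has_derivative ?A x) (at x)"
      by (rule has_derivative_add[OF has_derivative_scaleR[OF D(1)[OF x] d2]
            has_derivative_scaleR[OF D(2)[OF x] d1]])
    have "(\<Sum>b\<in>Basis. ?A x b \<bullet> b) = (\<Sum>b\<in>Basis. f1 x * (A2 x b \<bullet> b) + (g1 x \<bullet> b) * (g2 x \<bullet> b)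
             + f2 x * (A1 x b \<bullet> b) + (g1 x \<bullet> b) * (g2 x \<bullet> b))"
      by (intro sum.cong) (auto simp: inner_add_left algebra_simps)
    also have "\<dots> = f1 x * (\<Sum>b\<in>Basis. A2 x b \<bullet> b) + (g1 x \<bullet> g2 x)
             + f2 x * (\<Sum>b\<in>Basis. A1 x b \<bullet> b) + (g1 x \<bullet> g2 x)"
      unfolding sum.distrib sum_distrib_left[symmetric] euclidean_inner[symmetric] ..
    finally show "(\<Sum>b\<in>Basis. ?A x b \<bullet> b) = f1 x * l2 x + 2 * (g1 x \<bullet> g2 x) + f2 x * l1 x"
      using A x by simp
  next
    fix b :: 'a assume "b \<in> Basis"
    then have "continuous_on U (\<lambda>x. A1 x b \<bullet> b)" "continuous_on U (\<lambda>x. A2 x b \<bullet> b)"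
      using A by auto
    then show "continuous_on U (\<lambda>x. ?A x b \<bullet> b)"
      unfolding inner_add_left inner_scaleR_left using cont
      by (intro continuous_on_add continuous_on_mult continuous_on_inner[of _ g1]
          continuous_on_inner[of _ g2] continuous_on_const)
  qed
qed

lemma has_laplacian_on_cmult:
  fixes c :: real
  assumes "has_laplacian_on f g l U"
  shows "has_laplacian_on (\<lambda>x. c * f x) (\<lambda>x. c *\<^sub>R g x) (\<lambda>x. c * l x) U"
  using has_laplacian_on_mult[OF has_laplacian_on_const[of c U] assms] by simp

lemma has_laplacian_on_quadratic:
  fixes e :: "'a::euclidean_space"
  shows "has_laplacian_on (\<lambda>x. x \<bullet> e + k * (x \<bullet> x)) (\<lambda>x. e + (2 * k) *\<^sub>R x)
           (\<lambda>_. 2 * k * DIM('a)) U"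
  unfolding has_laplacian_on_def
proof (intro conjI exI[of _ "\<lambda>_ v. (2 * k) *\<^sub>R v"] ballI)
  fix x
  show "((\<lambda>x. x \<bullet> e + k * (x \<bullet> x)) has_derivative (\<lambda>v. (e + (2 * k) *\<^sub>R x) \<bullet> v)) (at x)"
    by (auto intro!: derivative_eq_intros simp: inner_add_left inner_add_right inner_commute[of e] fun_eq_iff inner_commute[of x])
  show "((\<lambda>x. e + (2 * k) *\<^sub>R x) has_derivative (*\<^sub>R) (2 * k)) (at x)"
    by (auto intro!: derivative_eq_intros)
qed (auto)

lemma has_laplacian_on_radial_power:
  fixes a :: real
  assumes "0 \<notin> U"
  shows "has_laplacian_on (\<lambda>x::'a::euclidean_space. (x \<bullet> x) powr a)
           (\<lambda>x. (2 * a * (x \<bullet> x) powr (a - 1)) *\<^sub>R x)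
           (\<lambda>x. 2 * a * (2 * a + DIM('a) - 2) * (x \<bullet> x) powr (a - 1)) U"
proof -
  have pos: "x \<bullet> x > 0" if "x \<in> U" for x
    using that assms by auto
  have D: "((\<lambda>x. (x \<bullet> x) powr a) has_derivative (\<lambda>v. ((2 * a * (x \<bullet> x) powr (a - 1)) *\<^sub>R x) \<bullet> v)) (at x)"
    if "x \<in> U" for x and a :: real
  proof -
    have "((\<lambda>s. s powr a) has_derivative (\<lambda>h. h * (a * (x \<bullet> x) powr (a - 1)))) (at (x \<bullet> x))"
      using has_real_derivative_powr[OF pos[OF that], of a] by (simp add: has_field_derivative_def mult.commute[of _ "a * _"])
    moreover have "((\<lambda>x. x \<bullet> x) has_derivative (\<lambda>v. 2 * (x \<bullet> v))) (at x)"
      by (auto intro!: derivative_eq_intros simp: inner_commute)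
    ultimately have "((\<lambda>x. (x \<bullet> x) powr a) has_derivative (\<lambda>v. (2 * (x \<bullet> v)) * (a * (x \<bullet> x) powr (a - 1)))) (at x)"
      by (rule has_derivative_compose[rotated])
    then show ?thesis
      by (rule has_derivative_eq_rhs) (auto simp: algebra_simps)
  qed
  let ?A = "\<lambda>x v. (2 * a * (x \<bullet> x) powr (a - 1)) *\<^sub>R v + (2 * a * (2 * (a - 1) * (x \<bullet> x) powr (a - 2) * (x \<bullet> v))) *\<^sub>R x"
  show ?thesis unfolding has_laplacian_on_def
  proof (intro conjI exI[of _ ?A] ballI)
    fix x assume x: "x \<in> U"
    show "((\<lambda>x. (x \<bullet> x) powr a) has_derivative (\<lambda>v. ((2 * a * (x \<bullet> x) powr (a - 1)) *\<^sub>R x) \<bullet> v)) (at x)"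
      by (rule D[OF x])
    have "((\<lambda>x. 2 * a * (x \<bullet> x) powr (a - 1)) has_derivative
             (\<lambda>v. 2 * a * (((2 * (a - 1) * (x \<bullet> x) powr (a - 1 - 1)) *\<^sub>R x) \<bullet> v))) (at x)"
      by (rule has_derivative_mult_right[OF D[OF x]])
    from has_derivative_scaleR[OF this has_derivative_ident]
    show "((\<lambda>x. (2 * a * (x \<bullet> x) powr (a - 1)) *\<^sub>R x) has_derivative ?A x) (at x)"
      by (rule has_derivative_eq_rhs) (simp add: fun_eq_iff)
    have pw: "(x \<bullet> x) powr (a - 2) * (x \<bullet> x) = (x \<bullet> x) powr (a - 1)"
      using pos[OF x] powr_add[of "x \<bullet> x" "a - 2" 1] by simp
    have "(\<Sum>b\<in>Basis. ?A x b \<bullet> b) = (\<Sum>b\<in>Basis. (2 * a * (x \<bullet> x) powr (a - 1)) * (b \<bullet> b)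
            + 4 * a * (a - 1) * (x \<bullet> x) powr (a - 2) * ((x \<bullet> b) * (x \<bullet> b)))"
      by (intro sum.cong) (auto simp: inner_add_left algebra_simps)
    also have "\<dots> = (2 * a * (x \<bullet> x) powr (a - 1)) * DIM('a) + 4 * a * (a - 1) * (x \<bullet> x) powr (a - 2) * (x \<bullet> x)"
      unfolding sum.distrib sum_distrib_left[symmetric] euclidean_inner[of x x, symmetric] by simp
    also have "\<dots> = 2 * a * (2 * a + DIM('a) - 2) * (x \<bullet> x) powr (a - 1)"
      unfolding pw[symmetric] by (simp add: algebra_simps)
    finally show "(\<Sum>b\<in>Basis. ?A x b \<bullet> b) = 2 * a * (2 * a + DIM('a) - 2) * (x \<bullet> x) powr (a - 1)" .
  next
    fix b :: 'a
    show "continuous_on U (\<lambda>x. ?A x b \<bullet> b)"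
      by (intro continuous_intros) (use assms in auto)
  qed
qed

text \<open>
  With \<open>F = \<nabla>\<phi> / \<phi>\<close> one has \<open>div F + |F|\<^sup>2 = \<Delta>\<phi> / \<phi> \<le> - V\<close>, while
  \<open>|\<nabla>u - u F|\<^sup>2 \<ge> 0\<close> gives \<open>|\<nabla>u|\<^sup>2 \<ge> div (u\<^sup>2 F) - u\<^sup>2 (div F + |F|\<^sup>2)\<close>. The
  divergence integrates to 0.
\<close>

lemma hardy_inequality_of_supersolution:
  fixes \<phi> u :: "'a::euclidean_space \<Rightarrow> real" and g Du :: "'a \<Rightarrow> 'a"
  assumes \<phi>: "has_laplacian_on \<phi> g l U" and U: "open U" and pos: "\<And>x. x \<in> U \<Longrightarrow> \<phi> x > 0"
    and super: "\<And>x. x \<in> U \<Longrightarrow> l x + V x * \<phi> x \<le> 0" and V: "continuous_on U V"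
    and u: "\<And>x. (u has_derivative (\<lambda>v. Du x \<bullet> v)) (at x)" and Du: "continuous_on UNIV Du"
    and K: "compact K" "K \<subseteq> U" and uK: "\<And>x. x \<notin> K \<Longrightarrow> u x = 0"
  shows "(\<integral>x. V x * (u x)\<^sup>2 \<partial>lborel) \<le> (\<integral>x. (norm (Du x))\<^sup>2 \<partial>lborel)"
proof -
  obtain A where A: "\<And>x. x \<in> U \<Longrightarrow> (g has_derivative A x) (at x)"
      "\<And>x. x \<in> U \<Longrightarrow> (\<Sum>b\<in>Basis. A x b \<bullet> b) = l x"
      "\<And>b. b \<in> Basis \<Longrightarrow> continuous_on U (\<lambda>x. A x b \<bullet> b)"
    using \<phi> unfolding has_laplacian_on_def by blast
  have \<phi>': "\<And>x. x \<in> U \<Longrightarrow> (\<phi> has_derivative (\<lambda>v. g x \<bullet> v)) (at x)"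
    using \<phi> unfolding has_laplacian_on_def by blast
  have c\<phi>: "continuous_on U \<phi>" and cg: "continuous_on U g"
    using has_laplacian_on_continuous[OF \<phi>] by auto
  have cu: "continuous_on UNIV u"
    using u by (auto intro!: continuous_at_imp_continuous_on has_derivative_continuous)
  have cuU: "continuous_on U u" "continuous_on U Du"
    using cu Du continuous_on_subset by blast+
  have near: "eventually (\<lambda>y. u y = 0) (nhds x)" if "x \<notin> K" for x
    by (rule eventually_mono[OF eventually_nhds_in_open[of "-K" x]])
      (use K(1) that uK in \<open>auto simp: compact_imp_closed open_Compl\<close>)
  have DuK: "Du x = 0" if "x \<notin> K" for x
  proof -
    have "((\<lambda>_. 0) has_derivative (\<lambda>v. Du x \<bullet> v)) (at x)"
      by (rule has_derivative_transform_within_open[OF u[of x], of "-K"])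
         (use K(1) that uK in \<open>auto simp: compact_imp_closed open_Compl\<close>)
    then have "(\<lambda>v. Du x \<bullet> v) = (\<lambda>_. 0)"
      using has_derivative_unique has_derivative_const by blast
    then show ?thesis by (metis inner_eq_zero_iff)
  qed
  \<comment> \<open>The components of the field \<open>u\<^sup>2 F\<close> and their derivatives in their own directions.\<close>
  define G where "G b x = (u x)\<^sup>2 * (g x \<bullet> b) / \<phi> x" for b x
  define d where "d b x = 2 * u x * (Du x \<bullet> b) * (g x \<bullet> b) / \<phi> x
      + (u x)\<^sup>2 * (A x b \<bullet> b) / \<phi> x - (u x)\<^sup>2 * (g x \<bullet> b)\<^sup>2 / (\<phi> x)\<^sup>2" for b x
  have ne: "\<And>x. x \<in> U \<Longrightarrow> \<phi> x \<noteq> 0" using pos by force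
  have cG: "continuous_on UNIV (G b)" for b
    by (rule continuous_on_zero_off_compact[OF _ U K])
       (auto simp: G_def uK intro!: continuous_intros cuU cg c\<phi> ne)
  have cd: "continuous_on UNIV (d b)" if "b \<in> Basis" for b
    by (rule continuous_on_zero_off_compact[OF _ U K])
       (auto simp: d_def uK ne intro!: continuous_intros cuU cg c\<phi> A(3)[OF that])
  have zero: "d b x = 0" "G b x = 0" if "x \<notin> K" for b x
    using uK[OF that] by (auto simp: d_def G_def)
  have deriv: "((\<lambda>t. G b (x + t *\<^sub>R b)) has_real_derivative d b x) (at 0)" for b x
  proof (cases "x \<in> K")
    case True
    then have x: "x \<in> U" using K by auto
    have lin: "((\<lambda>t. x + t *\<^sub>R b) has_derivative (\<lambda>t. t *\<^sub>R b)) (at 0)"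
      by (auto intro!: derivative_eq_intros)
    have comp: "((\<lambda>t. f (x + t *\<^sub>R b)) has_derivative (\<lambda>t. f' (t *\<^sub>R b))) (at 0)"
      if "(f has_derivative f') (at x)" for f :: "'a \<Rightarrow> 'c::real_normed_vector" and f'
      using has_derivative_compose[OF lin, of f f'] that by simp
    have 1: "((\<lambda>t. u (x + t *\<^sub>R b)) has_real_derivative (Du x \<bullet> b)) (at 0)"
      using comp[OF u[of x]] by (simp add: has_field_derivative_def mult.commute[of _ "_ \<bullet> _"])
    have 2: "((\<lambda>t. \<phi> (x + t *\<^sub>R b)) has_real_derivative (g x \<bullet> b)) (at 0)"
      using comp[OF \<phi>'[OF x]] by (simp add: has_field_derivative_def mult.commute[of _ "_ \<bullet> _"])
    have lA: "linear (A x)" using A(1)[OF x] by (rule has_derivative_linear)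
    have 3: "((\<lambda>t. g (x + t *\<^sub>R b) \<bullet> b) has_real_derivative (A x b \<bullet> b)) (at 0)"
      using has_derivative_inner_left[OF comp[OF A(1)[OF x]], of b]
      by (simp add: has_field_derivative_def linear_cmul[OF lA] mult.commute[of _ "_ \<bullet> _"])
    show ?thesis unfolding G_def d_def
      by (rule derivative_eq_intros 1 2 3 refl | use ne[OF x] in \<open>simp; fail\<close>)+
         (use ne[OF x] in \<open>simp add: field_simps power2_eq_square\<close>)
  next
    case False
    have "((\<lambda>t. x + t *\<^sub>R b) \<longlongrightarrow> x + 0 *\<^sub>R b) (nhds 0)"
      by (intro tendsto_intros) (simp add: filterlim_ident)
    then have "((\<lambda>t. x + t *\<^sub>R b) \<longlongrightarrow> x) (nhds 0)" by simp
    with near[OF False] have "eventually (\<lambda>t. u (x + t *\<^sub>R b) = 0) (nhds 0)"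
      by (auto simp: filterlim_iff)
    then have "eventually (\<lambda>t. G b (x + t *\<^sub>R b) = 0) (nhds 0)"
      by (auto simp: G_def elim!: eventually_mono)
    then show ?thesis
      using zero(1)[OF False] by (subst DERIV_cong_ev[where g="\<lambda>_. 0"]) auto
  qed
  have int0: "(\<integral>x. d b x \<partial>lborel) = 0" if "b \<in> Basis" for b
    by (rule integral_directional_derivative_eq_0[OF cG cd[OF that] deriv K(1) zero(2) zero(1)])
  have di: "integrable lborel (d b)" if "b \<in> Basis" for b
    by (rule integrable_continuous_compact_support[OF cd[OF that] K(1) zero(1)])
  have sum0: "(\<integral>x. (\<Sum>b\<in>Basis. d b x) \<partial>lborel) = 0"
    using int0 di by (subst Bochner_Integration.integral_sum) auto
  have sumi: "integrable lborel (\<lambda>x. \<Sum>b\<in>Basis. d b x)"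
    using di by auto
  have Vi: "integrable lborel (\<lambda>x. V x * (u x)\<^sup>2)"
    by (rule integrable_continuous_compact_support[OF continuous_on_zero_off_compact[OF _ U K] K(1)])
       (auto simp: uK intro!: continuous_intros V cuU)
  have Dui: "integrable lborel (\<lambda>x. (norm (Du x))\<^sup>2)"
    by (rule integrable_continuous_compact_support[OF _ K(1)])
       (auto simp: DuK intro!: continuous_intros Du)
  have pw: "V x * (u x)\<^sup>2 \<le> (norm (Du x))\<^sup>2 - (\<Sum>b\<in>Basis. d b x)" for x
  proof (cases "x \<in> K")
    case True
    then have x: "x \<in> U" using K by auto
    have "(\<Sum>b\<in>Basis. d b x) = (\<Sum>b\<in>Basis. 2 * u x / \<phi> x * ((Du x \<bullet> b) * (g x \<bullet> b))
      + (u x)\<^sup>2 / \<phi> x * (A x b \<bullet> b) - (u x)\<^sup>2 / (\<phi> x)\<^sup>2 * ((g x \<bullet> b) * (g x \<bullet> b)))"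
      unfolding d_def by (intro sum.cong) (auto simp: power2_eq_square)
    also have "\<dots> = 2 * u x / \<phi> x * (Du x \<bullet> g x) + (u x)\<^sup>2 / \<phi> x * l x - (u x)\<^sup>2 / (\<phi> x)\<^sup>2 * (g x \<bullet> g x)"
      unfolding sum.distrib sum_subtractf sum_distrib_left[symmetric] A(2)[OF x]
        euclidean_inner[symmetric] ..
    finally have S: "(\<Sum>b\<in>Basis. d b x) = \<dots>" .
    have "0 \<le> (Du x - (u x / \<phi> x) *\<^sub>R g x) \<bullet> (Du x - (u x / \<phi> x) *\<^sub>R g x)" by simp
    also have "\<dots> = (norm (Du x))\<^sup>2 - 2 * u x / \<phi> x * (Du x \<bullet> g x) + (u x)\<^sup>2 / (\<phi> x)\<^sup>2 * (g x \<bullet> g x)"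
      unfolding power2_norm_eq_inner power2_eq_square[of "u x"] power2_eq_square[of "\<phi> x"]
      by (simp add: inner_diff_left inner_diff_right inner_commute[of "g x" "Du x"]
          diff_divide_distrib right_diff_distrib)
    finally have 1: "2 * u x / \<phi> x * (Du x \<bullet> g x) - (u x)\<^sup>2 / (\<phi> x)\<^sup>2 * (g x \<bullet> g x) \<le> (norm (Du x))\<^sup>2" by simp
    have "(u x)\<^sup>2 / \<phi> x * (l x + V x * \<phi> x) \<le> 0"
      using super[OF x] pos[OF x] by (intro mult_nonneg_nonpos) auto
    then have "(u x)\<^sup>2 / \<phi> x * l x \<le> - (V x * (u x)\<^sup>2)"
      using ne[OF x] by (simp add: distrib_left mult.commute[of "V x"])
    with 1 S show ?thesis by linarith
  next
    case False
    then show ?thesis using uK DuK zero by simp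
  qed
  have "(\<integral>x. V x * (u x)\<^sup>2 \<partial>lborel) \<le> (\<integral>x. (norm (Du x))\<^sup>2 - (\<Sum>b\<in>Basis. d b x) \<partial>lborel)"
    by (rule integral_mono[OF Vi _ pw]) (intro Bochner_Integration.integrable_diff Dui sumi)
  also have "\<dots> = (\<integral>x. (norm (Du x))\<^sup>2 \<partial>lborel)"
    using sum0 by (simp add: Bochner_Integration.integral_diff[OF Dui sumi])
  finally show ?thesis .
qed

section \<open>A supersolution outside a ball\<close>

text \<open>
  All terms of the supersolution have the form \<open>w r\<^bsup>2\<alpha>\<^esup>\<close> or \<open>w\<^sup>2 r\<^bsup>2\<alpha>\<^esup>\<close>. Their Laplacians are
  again expressible through \<open>w\<close> and \<open>r\<close> alone, because \<open>\<nabla>w \<bullet> x = w + k r\<^sup>2\<close> and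
  \<open>|\<nabla>w|\<^sup>2 = 1 + 4 k w\<close>. Only the values of the Laplacians matter for the supersolution
  inequality; hence the existential quantifier over the gradient.
\<close>

lemma laplacian_quadratic_times_power:
  fixes e :: "'a::euclidean_space" and k \<alpha> :: real
  assumes "norm e = 1" "0 \<notin> U"
  defines "w \<equiv> \<lambda>x. x \<bullet> e + k * (x \<bullet> x)"
  shows "\<exists>g. has_laplacian_on (\<lambda>x. w x * (x \<bullet> x) powr \<alpha>) g
     (\<lambda>x. (x \<bullet> x) powr (\<alpha> - 1) *
        (2 * \<alpha> * (2 * \<alpha> + real DIM('a)) * w x + (4 * \<alpha> + 2 * real DIM('a)) * k * (x \<bullet> x))) U"
    and "\<exists>g. has_laplacian_on (\<lambda>x. w x * (w x * (x \<bullet> x) powr \<alpha>)) g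
     (\<lambda>x. (x \<bullet> x) powr (\<alpha> - 1) *
        (2 * \<alpha> * (2 * \<alpha> + real DIM('a) - 2) * (w x)\<^sup>2 + 8 * \<alpha> * w x * (w x + k * (x \<bullet> x))
          + (x \<bullet> x) * (2 * (1 + 4 * k * w x) + 4 * k * real DIM('a) * w x))) U"
proof -
  have pw: "(x \<bullet> x) powr \<alpha> = (x \<bullet> x) powr (\<alpha> - 1) * (x \<bullet> x)" if "x \<in> U" for x
  proof -
    have "x \<bullet> x > 0" using that assms(2) by auto
    then show ?thesis using powr_add[of "x \<bullet> x" "\<alpha> - 1" 1] by simp
  qed
  have ee: "e \<bullet> e = 1" using assms(1) by (simp add: norm_eq_1)
  have ge: "(e + (2 * k) *\<^sub>R x) \<bullet> x = w x + k * (x \<bullet> x)" for x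
    by (simp add: w_def inner_add_left inner_commute[of e x])
  have gg: "(e + (2 * k) *\<^sub>R x) \<bullet> (e + (2 * k) *\<^sub>R x) = 1 + 4 * k * w x" for x
    by (simp add: w_def inner_add_left inner_add_right ee inner_commute[of e x] distrib_left)
  have gX: "G \<bullet> (a *\<^sub>R x + b *\<^sub>R G) = a * (G \<bullet> x) + b * (G \<bullet> G)" for G x :: 'a and a b
    by (simp add: inner_add_right)
  note W = has_laplacian_on_quadratic[of e k U, folded w_def]
  note R = has_laplacian_on_radial_power[OF assms(2), of \<alpha>]
  note WR = has_laplacian_on_mult[OF W R]
  have cong: "\<exists>g. has_laplacian_on f g l' U"
    if "has_laplacian_on f g l U" "\<And>x. x \<in> U \<Longrightarrow> l x = l' x" for f g l l'
    using that unfolding has_laplacian_on_def by (intro exI[of _ g]) auto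
  show "\<exists>g. has_laplacian_on (\<lambda>x. w x * (x \<bullet> x) powr \<alpha>) g
     (\<lambda>x. (x \<bullet> x) powr (\<alpha> - 1) *
        (2 * \<alpha> * (2 * \<alpha> + real DIM('a)) * w x + (4 * \<alpha> + 2 * real DIM('a)) * k * (x \<bullet> x))) U"
    by (rule cong[OF WR]) (simp add: ge pw, simp add: algebra_simps)
  show "\<exists>g. has_laplacian_on (\<lambda>x. w x * (w x * (x \<bullet> x) powr \<alpha>)) g
     (\<lambda>x. (x \<bullet> x) powr (\<alpha> - 1) *
        (2 * \<alpha> * (2 * \<alpha> + real DIM('a) - 2) * (w x)\<^sup>2 + 8 * \<alpha> * w x * (w x + k * (x \<bullet> x))
          + (x \<bullet> x) * (2 * (1 + 4 * k * w x) + 4 * k * real DIM('a) * w x))) U"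
    by (rule cong[OF has_laplacian_on_mult[OF W WR]])
       (simp add: gX ge gg pw power2_eq_square, simp add: algebra_simps)
qed

text \<open>
  The supersolution is \<open>\<phi> = w r\<^bsup>-n/2\<^esup> (1 - n\<^sup>2 k r - (n/2) k w)\<close>. In
  \<open>\<Delta>\<phi> + (n\<^sup>2/4) \<phi> / r\<^sup>2\<close> the terms \<open>n k r\<^bsup>-n/2\<^esup>\<close> cancel, and the remaining term of first order in
  \<open>k\<close> is a positive multiple of \<open>- w (r - w/2)\<close>, which has the right sign because
  \<open>w \<le> r + k r\<^sup>2 \<le> 2 r\<close>. The terms of second order in \<open>k\<close> are negative.
\<close>

lemma exterior_ball_supersolution:
  fixes e :: "'a::euclidean_space" and k :: real
  assumes e: "norm e = 1" and k: "k > 0"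
  defines "n \<equiv> real DIM('a)"
  defines "U \<equiv> {x. x \<noteq> 0 \<and> x \<bullet> e + k * (x \<bullet> x) > 0 \<and> k * norm x * (n\<^sup>2 + n + 1) < 1}"
  shows "\<exists>\<phi> g l. has_laplacian_on \<phi> g l U \<and> (\<forall>x\<in>U. \<phi> x > 0 \<and> l x + n\<^sup>2 / 4 / (norm x)\<^sup>2 * \<phi> x \<le> 0)"
proof -
  define w where "w x = x \<bullet> e + k * (x \<bullet> x)" for x
  define a where "a = - n / 4"
  have U0: "0 \<notin> U" by (simp add: U_def)
  have n: "n \<ge> 1" unfolding n_def using DIM_positive[where 'a='a] by linarith
  obtain g1 where 1: "has_laplacian_on (\<lambda>x. w x * (x \<bullet> x) powr a) g1
     (\<lambda>x. (x \<bullet> x) powr (a - 1) * (2 * a * (2 * a + n) * w x + (4 * a + 2 * n) * k * (x \<bullet> x))) U"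
    using laplacian_quadratic_times_power(1)[OF e U0, of k a] unfolding w_def n_def by blast
  obtain g2 where 2: "has_laplacian_on (\<lambda>x. w x * (x \<bullet> x) powr (a + 1/2)) g2
     (\<lambda>x. (x \<bullet> x) powr (a + 1/2 - 1) *
        (2 * (a + 1/2) * (2 * (a + 1/2) + n) * w x + (4 * (a + 1/2) + 2 * n) * k * (x \<bullet> x))) U"
    using laplacian_quadratic_times_power(1)[OF e U0, of k "a + 1/2"] unfolding w_def n_def by blast
  obtain g3 where 3: "has_laplacian_on (\<lambda>x. w x * (w x * (x \<bullet> x) powr a)) g3
     (\<lambda>x. (x \<bullet> x) powr (a - 1) * (2 * a * (2 * a + n - 2) * (w x)\<^sup>2 + 8 * a * w x * (w x + k * (x \<bullet> x))
          + (x \<bullet> x) * (2 * (1 + 4 * k * w x) + 4 * k * n * w x))) U"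
    using laplacian_quadratic_times_power(2)[OF e U0, of k a] unfolding w_def n_def by blast
  note H = has_laplacian_on_add[OF has_laplacian_on_add[OF 1
      has_laplacian_on_cmult[OF 2, of "- (n\<^sup>2 * k)"]] has_laplacian_on_cmult[OF 3, of "- (n / 2 * k)"]]
  show ?thesis
  proof (intro exI conjI, rule H, intro ballI conjI)
    fix x assume x: "x \<in> U"
    define r where "r = norm x"
    define W where "W = w x"
    define P where "P = (x \<bullet> x) powr (a - 1)"
    have r: "r > 0" and W: "W > 0" and kr: "k * r * (n\<^sup>2 + n + 1) < 1"
      using x by (auto simp: U_def r_def W_def w_def)
    have q: "x \<bullet> x = r\<^sup>2" by (simp add: r_def power2_norm_eq_inner)
    have P: "P > 0" using r q by (simp add: P_def)
    have "x \<bullet> e \<le> r" using norm_cauchy_schwarz[of x e] e by (simp add: r_def)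
    then have Wr: "W \<le> r + k * r * r" by (simp add: W_def w_def q power2_eq_square)
    have "k * r \<le> k * r * (n\<^sup>2 + n + 1)"
      using mult_left_mono[of 1 "n\<^sup>2 + n + 1" "k * r"] k r n by simp
    then have "k * r \<le> 1" using kr by linarith
    then have "k * r * r \<le> 1 * r" using r by (intro mult_right_mono) auto
    then have W2: "W \<le> 2 * r" using Wr by simp
    have sq: "r\<^sup>2 powr b = r powr (2 * b)" for b
      using r powr_powr[of r 2 b] by simp
    have pa: "(x \<bullet> x) powr a = P * r\<^sup>2"
      using r powr_add[of "r\<^sup>2" "a - 1" 1] by (simp add: P_def q)
    have pa2: "(x \<bullet> x) powr (a + 1/2) = P * r\<^sup>2 * r"
      using r powr_add[of "r\<^sup>2" "a" "1/2"] pa by (simp add: q powr_half_sqrt)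
    have pa3: "(x \<bullet> x) powr (a + 1/2 - 1) = P * r"
      using r powr_add[of "r\<^sup>2" "a - 1" "1/2"] by (simp add: P_def q powr_half_sqrt)
    have "n * k * W \<le> n * k * (2 * r)" using W2 n k by (intro mult_left_mono) auto
    then have "n\<^sup>2 * k * r + n / 2 * k * W \<le> k * r * (n\<^sup>2 + n)"
      by (simp add: algebra_simps)
    also have "\<dots> < 1" using kr mult_pos_pos[OF k r] distrib_left[of "k * r" "n\<^sup>2 + n" 1] by linarith
    finally have "0 < P * r\<^sup>2 * W * (1 - (n\<^sup>2 * k * r + n / 2 * k * W))"
      using P W r by (intro mult_pos_pos) auto
    also have "\<dots> = w x * (x \<bullet> x) powr a + - (n\<^sup>2 * k) * (w x * (x \<bullet> x) powr (a + 1 / 2)) +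
         - (n / 2 * k) * (w x * (w x * (x \<bullet> x) powr a))"
      unfolding pa pa2 W_def[symmetric] by (simp add: algebra_simps)
    finally show "0 < \<dots>" .
    have "- (n\<^sup>2 * k * W * (r - W / 2)) - n\<^sup>2 * (n + 2) * k\<^sup>2 * r ^ 3 - n / 2 * k\<^sup>2 * r\<^sup>2 * W * (8 + 2 * n) \<le> 0"
    proof -
      have "0 \<le> n\<^sup>2 * k * W * (r - W / 2)" "0 \<le> n\<^sup>2 * (n + 2) * k\<^sup>2 * r ^ 3"
          "0 \<le> n / 2 * k\<^sup>2 * r\<^sup>2 * W * (8 + 2 * n)"
        using n k W r W2 by (auto intro!: mult_nonneg_nonneg)
      then show ?thesis by linarith
    qed
    then have "P * (- (n\<^sup>2 * k * W * (r - W / 2)) - n\<^sup>2 * (n + 2) * k\<^sup>2 * r ^ 3 - n / 2 * k\<^sup>2 * r\<^sup>2 * W * (8 + 2 * n)) \<le> 0"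
      using P by (simp add: mult_le_0_iff)
    also have "P * (- (n\<^sup>2 * k * W * (r - W / 2)) - n\<^sup>2 * (n + 2) * k\<^sup>2 * r ^ 3 - n / 2 * k\<^sup>2 * r\<^sup>2 * W * (8 + 2 * n))
      = P * (2 * a * (2 * a + n) * W + (4 * a + 2 * n) * k * r\<^sup>2) +
         - (n\<^sup>2 * k) * (P * r * (2 * (a + 1 / 2) * (2 * (a + 1 / 2) + n) * W + (4 * (a + 1 / 2) + 2 * n) * k * r\<^sup>2)) +
         - (n / 2 * k) * (P * (2 * a * (2 * a + n - 2) * W\<^sup>2 + 8 * a * W * (W + k * r\<^sup>2) + r\<^sup>2 * (2 * (1 + 4 * k * W) + 4 * k * n * W))) +
         n\<^sup>2 / 4 * (W * P + - (n\<^sup>2 * k) * (W * (P * r)) + - (n / 2 * k) * (W * (W * P)))"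
      unfolding a_def by (simp add: field_simps power2_eq_square power3_eq_cube)
    also have "n\<^sup>2 / 4 * (W * P + - (n\<^sup>2 * k) * (W * (P * r)) + - (n / 2 * k) * (W * (W * P)))
       = n\<^sup>2 / 4 / r\<^sup>2 * (W * (P * r\<^sup>2) + - (n\<^sup>2 * k) * (W * (P * r\<^sup>2 * r)) + - (n / 2 * k) * (W * (W * (P * r\<^sup>2))))"
      using r by (simp add: field_simps)
    finally show "(x \<bullet> x) powr (a - 1) * (2 * a * (2 * a + n) * w x + (4 * a + 2 * n) * k * (x \<bullet> x)) +
         - (n\<^sup>2 * k) * ((x \<bullet> x) powr (a + 1 / 2 - 1) * (2 * (a + 1 / 2) * (2 * (a + 1 / 2) + n) * w x + (4 * (a + 1 / 2) + 2 * n) * k * (x \<bullet> x))) +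
         - (n / 2 * k) * ((x \<bullet> x) powr (a - 1) * (2 * a * (2 * a + n - 2) * (w x)\<^sup>2 + 8 * a * w x * (w x + k * (x \<bullet> x)) + (x \<bullet> x) * (2 * (1 + 4 * k * w x) + 4 * k * n * w x))) +
         n\<^sup>2 / 4 / (norm x)\<^sup>2 *
         (w x * (x \<bullet> x) powr a + - (n\<^sup>2 * k) * (w x * (x \<bullet> x) powr (a + 1 / 2)) + - (n / 2 * k) * (w x * (w x * (x \<bullet> x) powr a))) \<le> 0"
      unfolding pa pa2 pa3 W_def[symmetric] P_def[symmetric] r_def[symmetric] unfolding q .
  qed
qed

section \<open>Gradients and integrals of test functions\<close>

lemma C_k_Suc_imp_continuous_gradient:
  fixes u :: "real ^ 'n::finite \<Rightarrow> real"
  assumes "C_k (Suc 0) u"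
  shows "(u has_derivative (\<lambda>v. gradient u x \<bullet> v)) (at x)" "continuous_on UNIV (gradient u)"
proof -
  have "(u has_derivative frechet_derivative u (at x)) (at x)"
    using assms by (auto simp: differentiable_on_def frechet_derivative_works[symmetric])
  moreover have "frechet_derivative u (at x) = (\<lambda>v. gradient u x \<bullet> v)"
  proof
    fix v :: "real ^ 'n"
    have lin: "linear (frechet_derivative u (at x))"
      using calculation by (rule has_derivative_linear)
    have "frechet_derivative u (at x) v = frechet_derivative u (at x) (\<Sum>i\<in>UNIV. (v $ i) *\<^sub>R axis i 1)"
      using basis_expansion[of v] by (simp add: scalar_mult_eq_scaleR)
    also have "\<dots> = (\<Sum>i\<in>UNIV. (v $ i) * partial_deriv i u x)"
      by (simp add: linear_sum[OF lin] linear_cmul[OF lin] partial_deriv_def)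
    also have "\<dots> = gradient u x \<bullet> v"
      by (simp add: inner_vec_def gradient_def mult.commute)
    finally show "frechet_derivative u (at x) v = gradient u x \<bullet> v" .
  qed
  ultimately show "(u has_derivative (\<lambda>v. gradient u x \<bullet> v)) (at x)" by simp
  show "continuous_on UNIV (gradient u)"
    unfolding gradient_def using assms by (auto intro!: continuous_on_vec_lambda)
qed

lemma gradient_eqI:
  assumes "(u has_derivative (\<lambda>v. g \<bullet> v)) (at x)"
  shows "gradient u x = g"
  using frechet_derivative_at[OF assms]
  by (simp add: gradient_def partial_deriv_def vec_eq_iff inner_axis fun_eq_iff flip: frechet_derivative_at[OF assms])

lemma gradient_eq_0_off_support:
  assumes "x \<notin> closure {x. u x \<noteq> 0}"
  shows "gradient u x = 0"
proof (rule gradient_eqI)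
  show "(u has_derivative (\<lambda>v. 0 \<bullet> v)) (at x)"
  proof (rule has_derivative_transform_within_open)
    show "((\<lambda>_. 0) has_derivative (\<lambda>v. 0 \<bullet> v)) (at x)" by simp
    show "open (- closure {x. u x \<noteq> 0})" by (simp add: open_Compl)
    show "x \<in> - closure {x. u x \<noteq> 0}" using assms by simp
    show "0 = u y" if "y \<in> - closure {x. u x \<noteq> 0}" for y
      using that closure_subset[of "{x. u x \<noteq> 0}"] by auto
  qed
qed

lemma set_lebesgue_integral_eq_lborel:
  fixes f :: "'a::euclidean_space \<Rightarrow> real"
  assumes "f \<in> borel_measurable borel" "\<And>x. x \<notin> \<Omega> \<Longrightarrow> f x = 0"
  shows "(LINT x:\<Omega>|lebesgue. f x) = (\<integral>x. f x \<partial>lborel)"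
proof -
  have "(\<lambda>x. indicator \<Omega> x *\<^sub>R f x) = f"
    using assms(2) by (force simp: indicator_def)
  then show ?thesis
    unfolding set_lebesgue_integral_def using assms(1) by (simp add: integral_completion)
qed

lemma test_function_integrals:
  fixes u :: "real ^ 'n::finite \<Rightarrow> real"
  assumes "u \<in> test_functions \<Omega>"
  shows "(LINT x:\<Omega>|lebesgue. (norm (gradient u x))\<^sup>2) = (\<integral>x. (norm (gradient u x))\<^sup>2 \<partial>lborel)"
    and "(LINT x:\<Omega>|lebesgue. (u x)\<^sup>2 / (norm x)\<^sup>2) = (\<integral>x. (u x)\<^sup>2 / (norm x)\<^sup>2 \<partial>lborel)"
proof -
  have C: "C_k (Suc 0) u" and sub: "closure {x. u x \<noteq> 0} \<subseteq> \<Omega>"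
    using assms by (auto simp: test_functions_def)
  have "gradient u \<in> borel_measurable borel"
    using C_k_Suc_imp_continuous_gradient(2)[OF C] by (rule borel_measurable_continuous_onI)
  then have "(\<lambda>x. (norm (gradient u x))\<^sup>2) \<in> borel_measurable borel" by measurable
  then show "(LINT x:\<Omega>|lebesgue. (norm (gradient u x))\<^sup>2) = (\<integral>x. (norm (gradient u x))\<^sup>2 \<partial>lborel)"
    by (rule set_lebesgue_integral_eq_lborel) (use sub gradient_eq_0_off_support in auto)
  have "continuous_on UNIV u"
    using C_k_Suc_imp_continuous_gradient(1)[OF C]
    by (auto intro!: continuous_at_imp_continuous_on has_derivative_continuous)
  then have [measurable]: "u \<in> borel_measurable borel" by (rule borel_measurable_continuous_onI)
  have "(\<lambda>x. (u x)\<^sup>2 / (norm x)\<^sup>2) \<in> borel_measurable borel" by measurable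
  then show "(LINT x:\<Omega>|lebesgue. (u x)\<^sup>2 / (norm x)\<^sup>2) = (\<integral>x. (u x)\<^sup>2 / (norm x)\<^sup>2 \<partial>lborel)"
    by (rule set_lebesgue_integral_eq_lborel) (use sub closure_subset[of "{x. u x \<noteq> 0}"] in auto)
qed

section \<open>The Hardy inequality under an exterior ball condition\<close>

lemma hardy_inequality_exterior_ball:
  fixes \<Omega> :: "(real ^ 'n::finite) set" and e :: "real ^ 'n"
  assumes \<Omega>: "open \<Omega>" "bounded \<Omega>" "0 \<notin> \<Omega>" and e: "norm e = 1" and \<rho>: "\<rho> > 0"
    and ball: "ball (- \<rho> *\<^sub>R e) \<rho> \<inter> closure \<Omega> = {}"
    and small: "(SUP x\<in>\<Omega>. norm x) * ((real CARD('n))\<^sup>2 + real CARD('n) + 1) \<le> \<rho>"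
  shows "hardy_inequality \<Omega> ((real CARD('n))\<^sup>2 / 4)"
proof -
  let ?n = "real CARD('n)"
  define k where "k = 1 / (2 * \<rho>)"
  have k: "k > 0" using \<rho> by (simp add: k_def)
  define U where "U = {x::real^'n. x \<noteq> 0 \<and> x \<bullet> e + k * (x \<bullet> x) > 0 \<and> k * norm x * (?n\<^sup>2 + ?n + 1) < 1}"
  have ee: "e \<bullet> e = 1" using e by (simp add: norm_eq_1)
  \<comment> \<open>An open set that misses the open ball misses its closure, so \<open>w\<close> is strictly positive on \<open>\<Omega>\<close>.\<close>
  have "\<Omega> \<inter> cball (- \<rho> *\<^sub>R e) \<rho> = {}"
    using ball \<rho> \<Omega>(1) open_Int_closure_eq_empty[OF \<Omega>(1), of "ball (- \<rho> *\<^sub>R e) \<rho>"]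
      closure_subset[of \<Omega>] by auto
  then have out: "norm (x + \<rho> *\<^sub>R e) > \<rho>" if "x \<in> \<Omega>" for x
    using that by (auto simp: dist_norm norm_minus_commute[of _ x] disjoint_iff not_le)
  have "\<Omega> \<subseteq> U"
  proof
    fix x assume x: "x \<in> \<Omega>"
    have "\<rho>\<^sup>2 < (norm (x + \<rho> *\<^sub>R e))\<^sup>2"
      using out[OF x] \<rho> by (intro power_strict_mono) auto
    then have "0 < x \<bullet> x + 2 * \<rho> * (x \<bullet> e)"
      unfolding power2_norm_eq_inner
      by (simp add: inner_add_left inner_add_right ee power2_eq_square[of \<rho>] inner_commute[of e x] distrib_left)
    then have "0 < x \<bullet> e + k * (x \<bullet> x)"
      using \<rho> by (simp add: k_def field_simps)
    moreover have "norm x \<le> (SUP x\<in>\<Omega>. norm x)"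
      using x \<Omega>(2) by (intro cSUP_upper) (auto simp: bounded_iff bdd_above_def)
    then have "norm x * (?n\<^sup>2 + ?n + 1) \<le> \<rho>"
      using small mult_right_mono[of "norm x" "SUP x\<in>\<Omega>. norm x" "?n\<^sup>2 + ?n + 1"] by simp
    then have "k * norm x * (?n\<^sup>2 + ?n + 1) < 1"
      using mult_left_mono[of "norm x * (?n\<^sup>2 + ?n + 1)" \<rho> k] k \<rho> by (simp add: k_def mult.assoc)
    ultimately show "x \<in> U" using x \<Omega>(3) by (auto simp: U_def)
  qed
  have "open U"
    unfolding U_def by (intro open_Collect_conj open_Collect_less open_Collect_neq continuous_intros)
  obtain \<phi> g l where \<phi>: "has_laplacian_on \<phi> g l U"
      "\<And>x. x \<in> U \<Longrightarrow> \<phi> x > 0" "\<And>x. x \<in> U \<Longrightarrow> l x + ?n\<^sup>2 / 4 / (norm x)\<^sup>2 * \<phi> x \<le> 0"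
    using exterior_ball_supersolution[OF e k] unfolding U_def by auto
  show ?thesis unfolding hardy_inequality_def
  proof
    fix u :: "real^'n \<Rightarrow> real" assume u: "u \<in> test_functions \<Omega>"
    then have C: "C_k (Suc 0) u" and K: "compact (closure {x. u x \<noteq> 0})" "closure {x. u x \<noteq> 0} \<subseteq> \<Omega>"
      by (auto simp: test_functions_def)
    have "(\<integral>x. ?n\<^sup>2 / 4 / (norm x)\<^sup>2 * (u x)\<^sup>2 \<partial>lborel) \<le> (\<integral>x. (norm (gradient u x))\<^sup>2 \<partial>lborel)"
    proof (rule hardy_inequality_of_supersolution[OF \<phi>(1) \<open>open U\<close> \<phi>(2,3) _
          C_k_Suc_imp_continuous_gradient[OF C] K(1)])
      show "continuous_on U (\<lambda>x. ?n\<^sup>2 / 4 / (norm x)\<^sup>2)"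
        by (intro continuous_intros) (auto simp: U_def)
      show "closure {x. u x \<noteq> 0} \<subseteq> U" using K(2) \<open>\<Omega> \<subseteq> U\<close> by auto
      show "u x = 0" if "x \<notin> closure {x. u x \<noteq> 0}" for x
        using that closure_subset[of "{x. u x \<noteq> 0}"] by auto
    qed
    also have "(\<integral>x. ?n\<^sup>2 / 4 / (norm x)\<^sup>2 * (u x)\<^sup>2 \<partial>lborel) = ?n\<^sup>2 / 4 * (\<integral>x. (u x)\<^sup>2 / (norm x)\<^sup>2 \<partial>lborel)"
      by (simp add: integral_mult_right_zero[symmetric] del: integral_mult_right_zero)
    finally show "?n\<^sup>2 / 4 * (LINT x:\<Omega>|lebesgue. (u x)\<^sup>2 / (norm x)\<^sup>2) \<le> (LINT x:\<Omega>|lebesgue. (norm (gradient u x))\<^sup>2)"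
      unfolding test_function_integrals[OF u] .
  qed
qed

section \<open>Functions of class C-k on open sets\<close>

text \<open>
  The trial functions are singular expressions near the origin, where they vanish identically.
  Their smoothness is obtained by gluing, which needs the classes \<open>C_k\<close> relative to open sets.
\<close>

primrec C_k_on :: "(real ^ 'n::finite) set \<Rightarrow> nat \<Rightarrow> (real ^ 'n \<Rightarrow> real) \<Rightarrow> bool" where
  "C_k_on U 0 f \<longleftrightarrow> continuous_on U f"
| "C_k_on U (Suc k) f \<longleftrightarrow> (\<forall>x\<in>U. f differentiable (at x)) \<and> (\<forall>i. C_k_on U k (partial_deriv i f))"

lemma C_k_on_UNIV: "C_k_on UNIV k f \<longleftrightarrow> C_k k f"
  by (induction k arbitrary: f) (auto simp: differentiable_on_def)

lemma partial_deriv_eqI: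
  "(f has_derivative f') (at x) \<Longrightarrow> partial_deriv i f x = f' (axis i 1)"
  unfolding partial_deriv_def by (simp add: frechet_derivative_at[symmetric])

lemma has_derivative_frechet:
  "f differentiable (at x) \<Longrightarrow> (f has_derivative frechet_derivative f (at x)) (at x)"
  by (simp add: frechet_derivative_works)

lemma C_k_on_cong:
  assumes "open U" "C_k_on U k f" "\<And>x. x \<in> U \<Longrightarrow> f x = g x"
  shows "C_k_on U k g"
  using assms(2,3)
proof (induction k arbitrary: f g)
  case 0
  then show ?case by (simp cong: continuous_on_cong)
next
  case (Suc k)
  have D: "(g has_derivative frechet_derivative f (at x)) (at x)" if "x \<in> U" for x
    by (rule has_derivative_transform_within_open[OF has_derivative_frechet \<open>open U\<close> that])
      (use Suc.prems that in auto)
  then have "partial_deriv i f x = partial_deriv i g x" if "x \<in> U" for i x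
    using partial_deriv_eqI[OF D[OF that]] by (simp add: partial_deriv_def)
  then have "C_k_on U k (partial_deriv i g)" for i
    using Suc.IH[of "partial_deriv i f" "partial_deriv i g"] Suc.prems by auto
  with D show ?case by (auto simp: differentiable_def)
qed

lemma C_k_on_Un:
  assumes "open U" "open V" "C_k_on U k f" "C_k_on V k f"
  shows "C_k_on (U \<union> V) k f"
  using assms(3,4) by (induction k arbitrary: f) (auto intro: continuous_on_open_Un assms)

lemma C_k_on_SucD:
  assumes "C_k_on U (Suc k) f"
  shows "C_k_on U k f"
  using assms
proof (induction k arbitrary: f)
  case 0
  then show ?case
    by (auto intro!: continuous_at_imp_continuous_on differentiable_imp_continuous_within)
next
  case (Suc k)
  then show ?case by (metis C_k_on.simps(2))
qed

lemma C_k_on_const: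
  fixes U :: "(real ^ 'n::finite) set"
  shows "C_k_on U k (\<lambda>_. c)"
proof (induction k arbitrary: c)
  case (Suc k)
  have "partial_deriv i (\<lambda>_::real^'n. c) = (\<lambda>_. 0)" for i
    by (rule ext, rule partial_deriv_eqI[OF has_derivative_const, THEN trans]) simp
  then show ?case using Suc by simp
qed auto

lemma C_k_on_add:
  assumes "open U" "C_k_on U k f" "C_k_on U k g"
  shows "C_k_on U k (\<lambda>x. f x + g x)"
  using assms(2,3)
proof (induction k arbitrary: f g)
  case 0
  then show ?case by (auto intro: continuous_on_add)
next
  case (Suc k)
  have "C_k_on U k (partial_deriv i (\<lambda>x. f x + g x))" for i
  proof (rule C_k_on_cong[OF \<open>open U\<close>])
    show "C_k_on U k (\<lambda>x. partial_deriv i f x + partial_deriv i g x)"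
      using Suc by auto
    fix x assume "x \<in> U"
    then have "f differentiable (at x)" "g differentiable (at x)" using Suc.prems by auto
    from this[THEN has_derivative_frechet]
    show "partial_deriv i f x + partial_deriv i g x = partial_deriv i (\<lambda>x. f x + g x) x"
      by (subst partial_deriv_eqI[OF has_derivative_add]) (auto simp: partial_deriv_def)
  qed
  then show ?case using Suc.prems by auto
qed

lemma C_k_on_mult:
  assumes "open U" "C_k_on U k f" "C_k_on U k g"
  shows "C_k_on U k (\<lambda>x. f x * g x)"
  using assms(2,3)
proof (induction k arbitrary: f g)
  case 0
  then show ?case by (auto intro: continuous_on_mult)
next
  case (Suc k)
  have "C_k_on U k (partial_deriv i (\<lambda>x. f x * g x))" for i
  proof (rule C_k_on_cong[OF \<open>open U\<close>])
    show "C_k_on U k (\<lambda>x. f x * partial_deriv i g x + partial_deriv i f x * g x)"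
      using Suc.prems C_k_on_SucD[OF Suc.prems(1)] C_k_on_SucD[OF Suc.prems(2)]
      by (intro C_k_on_add[OF \<open>open U\<close>] Suc.IH) auto
    fix x assume "x \<in> U"
    then have "f differentiable (at x)" "g differentiable (at x)" using Suc.prems by auto
    from this[THEN has_derivative_frechet]
    show "f x * partial_deriv i g x + partial_deriv i f x * g x = partial_deriv i (\<lambda>x. f x * g x) x"
      by (subst partial_deriv_eqI[OF has_derivative_mult]) (auto simp: partial_deriv_def)
  qed
  then show ?case using Suc.prems by auto
qed

lemma C_k_on_inner: "C_k_on U k (\<lambda>x. x \<bullet> v)"
proof (cases k)
  case (Suc m)
  have d: "((\<lambda>x. x \<bullet> v) has_derivative (\<lambda>h. h \<bullet> v)) (at x)" for x
    by (auto intro!: derivative_eq_intros)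
  have "partial_deriv i (\<lambda>x. x \<bullet> v) = (\<lambda>_. axis i 1 \<bullet> v)" for i
    by (rule ext, rule partial_deriv_eqI[OF d])
  with d show ?thesis using Suc by (auto simp: C_k_on_const differentiable_def)
qed (auto intro!: continuous_intros)

lemma C_k_on_inner_self:
  assumes "open U" shows "C_k_on U k (\<lambda>x. x \<bullet> x)"
proof -
  have "C_k_on U k (\<lambda>x. \<Sum>i\<in>I. (x \<bullet> axis i 1) * (x \<bullet> axis i 1))" if "finite I" for I
    using that
  proof induction
    case (insert i I)
    then show ?case
      by simp (intro C_k_on_add C_k_on_mult C_k_on_inner assms insert.IH)
  qed (simp add: C_k_on_const)
  from this[of UNIV] show ?thesis
    by (simp add: inner_vec_def[of x x for x] inner_axis)
qed

text \<open>
  A set of real functions that contains a derivative of each of its members consists of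
  smooth functions. Exhibiting such a set replaces formulas for higher derivatives.
\<close>

definition derivative_closed_on :: "real set \<Rightarrow> (real \<Rightarrow> real) set \<Rightarrow> bool" where
  "derivative_closed_on V S \<longleftrightarrow>
     (\<forall>\<psi>\<in>S. \<exists>\<psi>'\<in>S. \<forall>t\<in>V. (\<psi> has_real_derivative \<psi>' t) (at t))"

lemma C_k_on_compose:
  assumes "open U" "derivative_closed_on V S" "\<psi> \<in> S" "\<And>k. C_k_on U k f" "f ` U \<subseteq> V"
  shows "C_k_on U k (\<lambda>x. \<psi> (f x))"
  using assms(3)
proof (induction k arbitrary: \<psi>)
  case 0
  then obtain \<psi>' where "\<And>t. t \<in> V \<Longrightarrow> (\<psi> has_real_derivative \<psi>' t) (at t)"
    using assms(2) unfolding derivative_closed_on_def by blast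
  then have "continuous_on V \<psi>"
    by (auto intro!: continuous_at_imp_continuous_on DERIV_isCont)
  moreover have "continuous_on U f" using assms(4)[of 0] by simp
  ultimately show ?case using assms(5) by (auto intro: continuous_on_compose2)
next
  case (Suc k)
  obtain \<psi>' where \<psi>': "\<psi>' \<in> S" "\<And>t. t \<in> V \<Longrightarrow> (\<psi> has_real_derivative \<psi>' t) (at t)"
    using assms(2) Suc.prems unfolding derivative_closed_on_def by blast
  have f: "(f has_derivative frechet_derivative f (at x)) (at x)" if "x \<in> U" for x
    using assms(4)[of "Suc 0"] that by (auto intro: has_derivative_frechet)
  have d: "((\<lambda>x. \<psi> (f x)) has_derivative (\<lambda>h. \<psi>' (f x) * frechet_derivative f (at x) h)) (at x)"
    if "x \<in> U" for x
    using has_derivative_compose[OF f[OF that] \<psi>'(2)[unfolded has_field_derivative_def]] assms(5) that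
    by auto
  have "C_k_on U k (partial_deriv i (\<lambda>x. \<psi> (f x)))" for i
  proof (rule C_k_on_cong[OF \<open>open U\<close>])
    show "C_k_on U k (\<lambda>x. \<psi>' (f x) * partial_deriv i f x)"
      using assms(4)[of "Suc k"] by (intro C_k_on_mult[OF \<open>open U\<close>] Suc.IH \<psi>'(1)) auto
  qed (simp add: partial_deriv_eqI[OF d], simp add: partial_deriv_def)
  with d show ?case by (auto simp: differentiable_def)
qed

lemma C_k_scaling:
  assumes "C_k k f"
  shows "C_k k (\<lambda>x. f (c *\<^sub>R x))"
proof -
  have "C_k_on UNIV k f \<Longrightarrow> C_k_on UNIV k (\<lambda>x. f (c *\<^sub>R x))"
  proof (induction k arbitrary: f)
    case 0
    then show ?case by (auto intro!: continuous_on_compose2[of UNIV f] continuous_intros)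
  next
    case (Suc k)
    have sc: "((\<lambda>x. c *\<^sub>R x) has_derivative (\<lambda>h. c *\<^sub>R h)) (at x)" for x
      by (auto intro!: derivative_eq_intros)
    have f: "(f has_derivative frechet_derivative f (at x)) (at x)" for x
      using Suc.prems by (auto intro: has_derivative_frechet)
    have d: "((\<lambda>x. f (c *\<^sub>R x)) has_derivative (\<lambda>h. frechet_derivative f (at (c *\<^sub>R x)) (c *\<^sub>R h))) (at x)" for x
      by (rule has_derivative_compose[OF sc f])
    have "partial_deriv i (\<lambda>x. f (c *\<^sub>R x)) = (\<lambda>x. c * partial_deriv i f (c *\<^sub>R x))" for i
      by (rule ext)
        (simp add: partial_deriv_eqI[OF d] linear_cmul[OF has_derivative_linear[OF f]] partial_deriv_def)
    then have "C_k_on UNIV k (partial_deriv i (\<lambda>x. f (c *\<^sub>R x)))" for i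
      using Suc by (auto intro!: C_k_on_mult C_k_on_const)
    with d show ?case by (auto simp: differentiable_def)
  qed
  then show ?thesis using assms by (simp add: C_k_on_UNIV)
qed

section \<open>Smooth functions of one variable\<close>

text \<open>
  These are the functions \<open>P(1/t) exp(-1/t)\<close> with a polynomial \<open>P\<close>, continued by 0 to
  \<open>t \<le> 0\<close>. Differentiation maps \<open>P(y)\<close> to \<open>y\<^sup>2 (P(y) - P'(y))\<close>, so the family is closed under
  derivatives and contains the standard smooth function that is flat at 0.
\<close>

definition flat :: "real poly \<Rightarrow> real \<Rightarrow> real" where
  "flat p t = (if t > 0 then poly p (1 / t) * exp (- 1 / t) else 0)"

lemma tendsto_poly_exp_at_top:
  fixes p :: "real poly"
  shows "((\<lambda>y. poly p y * exp (- y)) \<longlongrightarrow> 0) at_top"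
proof -
  have "((\<lambda>y. \<Sum>i\<le>degree p. coeff p i * (y ^ i / exp y)) \<longlongrightarrow> (\<Sum>i\<le>degree p. coeff p i * 0)) at_top"
    by (intro tendsto_intros tendsto_power_div_exp_0)
  then show ?thesis
    by (simp add: poly_altdef exp_minus sum_distrib_right divide_inverse mult.assoc)
qed

lemma flat_has_derivative:
  "(flat p has_real_derivative flat ([:0, 0, 1:] * (p - pderiv p)) t) (at t)"
proof -
  consider "t > 0" | "t < 0" | "t = 0" by linarith
  then show ?thesis
  proof cases
    case 1
    have "((\<lambda>t. poly p (1 / t) * exp (- 1 / t)) has_real_derivative
            flat ([:0, 0, 1:] * (p - pderiv p)) t) (at t)"
      using 1 by (auto intro!: derivative_eq_intros simp: flat_def)
        (simp add: field_simps power2_eq_square)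
    then show ?thesis
      by (rule has_field_derivative_transform_within_open[of _ _ _ "{0<..}"]) (use 1 in \<open>auto simp: flat_def\<close>)
  next
    case 2
    have "((\<lambda>_. 0) has_real_derivative 0) (at t)" by simp
    then have "(flat p has_real_derivative 0) (at t)"
      by (rule has_field_derivative_transform_within_open[of _ _ _ "{..<0}"]) (use 2 in \<open>auto simp: flat_def\<close>)
    then show ?thesis using 2 by (simp add: flat_def)
  next
    case 3
    have "((\<lambda>y. poly (pCons 0 p) y * exp (- y)) \<longlongrightarrow> 0) at_top"
      by (rule tendsto_poly_exp_at_top)
    then have "((\<lambda>h. poly (pCons 0 p) (inverse h) * exp (- inverse h)) \<longlongrightarrow> 0) (at_right 0)"
      by (rule filterlim_compose[OF _ filterlim_inverse_at_top_right])
    then have "((\<lambda>h. (flat p h - flat p 0) / h) \<longlongrightarrow> 0) (at_right 0)"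
      by (rule Lim_transform_eventually)
        (auto simp: eventually_at_right_less flat_def divide_inverse mult_ac
          intro!: eventually_mono[OF eventually_at_right_less])
    moreover have "((\<lambda>h. (flat p h - flat p 0) / h) \<longlongrightarrow> 0) (at_left 0)"
      by (rule Lim_transform_eventually[OF tendsto_const])
        (auto simp: flat_def eventually_at_filter)
    ultimately have "((\<lambda>h. (flat p h - flat p 0) / h) \<longlongrightarrow> 0) (at 0)"
      by (simp add: filterlim_split_at)
    then show ?thesis using 3 by (simp add: has_field_derivative_iff flat_def)
  qed
qed

lemma derivative_closed_flat: "derivative_closed_on UNIV (range flat)"
  unfolding derivative_closed_on_def using flat_has_derivative by blast

lemma derivative_closed_ln_powr:
  "derivative_closed_on {0<..} (insert ln (range (\<lambda>(c, a). \<lambda>s. c * s powr a)))"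
  unfolding derivative_closed_on_def
proof
  let ?S = "insert ln (range (\<lambda>(c::real, a::real). \<lambda>s::real. c * s powr a))"
  fix \<psi> assume "\<psi> \<in> ?S"
  then consider "\<psi> = ln" | c a where "\<psi> = (\<lambda>s. c * s powr a)" by auto
  then show "\<exists>\<psi>'\<in>?S. \<forall>t\<in>{0<..}. (\<psi> has_real_derivative \<psi>' t) (at t)"
  proof cases
    case 1
    have "(\<lambda>s. 1 * s powr (-1)) \<in> ?S" by (auto intro!: image_eqI[of _ _ "(1, -1)"])
    then show ?thesis
      by (rule bexI[rotated]) (auto simp: 1 powr_minus inverse_eq_divide intro!: derivative_eq_intros)
  next
    case (2 c a)
    have "(\<lambda>s. (c * a) * s powr (a - 1)) \<in> ?S" by (auto intro!: image_eqI[of _ _ "(c * a, a - 1)"])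
    then show ?thesis
      by (rule bexI[rotated]) (auto simp: 2 intro!: derivative_eq_intros)
  qed
qed

abbreviation flat0 :: "real \<Rightarrow> real" where "flat0 \<equiv> flat 1"
abbreviation flat1 :: "real \<Rightarrow> real" where "flat1 \<equiv> flat [:0, 0, 1:]"

lemma flat0_has_derivative: "(flat0 has_real_derivative flat1 t) (at t)"
  using flat_has_derivative[of 1 t] by simp

lemma continuous_on_flat: "continuous_on S (flat p)"
  using flat_has_derivative by (auto intro!: continuous_at_imp_continuous_on DERIV_isCont)

lemma flat_nonpos: "t \<le> 0 \<Longrightarrow> flat p t = 0"
  by (simp add: flat_def)

lemma exp_quadratic_lower_bound:
  fixes y :: real assumes "y \<ge> 0" shows "1 + y + y\<^sup>2 / 2 \<le> exp y"
  using exp_lower_Taylor_quadratic[OF assms] by simp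

lemma flat0_bounds: "0 \<le> flat0 t" "flat0 t \<le> 1"
  by (auto simp: flat_def)

lemma flat0_ge: "t \<ge> 1 \<Longrightarrow> exp (- 1) \<le> flat0 t"
  by (auto simp: flat_def)

lemma flat1_bounds: "0 \<le> flat1 t" "flat1 t \<le> 2"
proof -
  show "0 \<le> flat1 t" by (simp add: flat_def)
  show "flat1 t \<le> 2"
  proof (cases "t > 0")
    case True
    define y where "y = 1 / t"
    have y: "y > 0" using True by (simp add: y_def)
    have "flat1 t = y\<^sup>2 / exp y"
      using True by (simp add: flat_def y_def exp_minus power2_eq_square field_simps)
    moreover have "y\<^sup>2 \<le> 2 * exp y" using exp_quadratic_lower_bound[of y] y by linarith
    ultimately show ?thesis by (simp add: divide_le_eq)
  qed (simp add: flat_def)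
qed

text \<open>
  A smooth function supported on \<open>[0, 3]\<close> that stays above \<open>exp (- 2)\<close> on the middle third
  \<open>[1, 2]\<close>. The three thirds will correspond to three annuli of equal mass.
\<close>

definition bump :: "real \<Rightarrow> real" where
  "bump t = flat0 t * flat0 (3 - t)"

definition bump' :: "real \<Rightarrow> real" where
  "bump' t = flat1 t * flat0 (3 - t) - flat0 t * flat1 (3 - t)"

lemma bump_has_derivative: "(bump has_real_derivative bump' t) (at t)"
proof -
  have "((\<lambda>t. flat0 (3 - t)) has_real_derivative flat1 (3 - t) * (- 1)) (at t)"
    by (rule DERIV_chain2[OF flat0_has_derivative]) (auto intro!: derivative_eq_intros)
  from DERIV_mult[OF flat0_has_derivative this]
  show ?thesis unfolding bump_def[abs_def] bump'_def by (simp add: algebra_simps)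
qed

lemma continuous_on_bump: "continuous_on S bump" "continuous_on S bump'"
  unfolding bump_def[abs_def] bump'_def[abs_def]
  by (intro continuous_intros continuous_on_flat continuous_on_compose2[OF continuous_on_flat[of UNIV]]; simp)+

lemma bump_support: "t \<le> 0 \<or> 3 \<le> t \<Longrightarrow> bump t = 0" "t \<le> 0 \<or> 3 \<le> t \<Longrightarrow> bump' t = 0"
  by (auto simp: bump_def bump'_def flat_nonpos)

lemma bump_bounds: "0 \<le> bump t" "bump t \<le> 1" "\<bar>bump' t\<bar> \<le> 2"
proof -
  show "0 \<le> bump t" "bump t \<le> 1"
    using flat0_bounds by (auto simp: bump_def intro!: mult_le_one)
  have m: "0 \<le> flat1 a * flat0 b" "flat1 a * flat0 b \<le> 2" for a b
    using mult_mono[of "flat1 a" 2 "flat0 b" 1] flat0_bounds[of b] flat1_bounds[of a] by auto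
  show "\<bar>bump' t\<bar> \<le> 2"
    using m[of t "3 - t"] m[of "3 - t" t] by (simp add: bump'_def mult.commute[of "flat0 t"] abs_le_iff)
qed

lemma bump_ge: "1 \<le> t \<Longrightarrow> t \<le> 2 \<Longrightarrow> exp (- 2) \<le> bump t"
  using mult_mono[OF flat0_ge[of t] flat0_ge[of "3 - t"]] flat0_bounds
  by (simp add: bump_def exp_add[symmetric])

text \<open>
  The argument \<open>j\<close> tends to infinity. The function vanishes for \<open>w \<le> 1/j\<close> and is the
  rescaling \<open>P(j w) / j\<close> of one function \<open>P\<close>; therefore its derivative is bounded uniformly in
  \<open>j\<close>, as dominated convergence requires.
\<close>

definition positive_part_approx :: "real \<Rightarrow> real \<Rightarrow> real" where
  "positive_part_approx j w = w * flat0 (j * w - 1)"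

definition positive_part_approx' :: "real \<Rightarrow> real \<Rightarrow> real" where
  "positive_part_approx' j w = flat0 (j * w - 1) + (j * w) * flat1 (j * w - 1)"

lemma positive_part_approx_has_derivative:
  "(positive_part_approx j has_real_derivative positive_part_approx' j w) (at w)"
proof -
  have "((\<lambda>w. flat0 (j * w - 1)) has_real_derivative flat1 (j * w - 1) * j) (at w)"
    by (rule DERIV_chain2[OF flat0_has_derivative]) (auto intro!: derivative_eq_intros)
  from DERIV_mult[OF DERIV_ident this]
  show ?thesis
    unfolding positive_part_approx_def[abs_def] positive_part_approx'_def by (simp add: algebra_simps)
qed

lemma positive_part_approx_support:
  assumes "j > 0" "w \<le> 1 / j"
  shows "positive_part_approx j w = 0" "positive_part_approx' j w = 0"
proof -
  have "j * w - 1 \<le> 0" using assms by (simp add: field_simps)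
  then show "positive_part_approx j w = 0" "positive_part_approx' j w = 0"
    by (simp_all add: positive_part_approx_def positive_part_approx'_def flat_nonpos)
qed

lemma positive_part_approx_bounds:
  assumes "j > 0"
  shows "\<bar>positive_part_approx j w\<bar> \<le> \<bar>w\<bar>" "0 \<le> positive_part_approx' j w" "positive_part_approx' j w \<le> 2"
proof -
  show "\<bar>positive_part_approx j w\<bar> \<le> \<bar>w\<bar>"
    using flat0_bounds[of "j * w - 1"] by (simp add: positive_part_approx_def abs_mult mult_left_le)
  show "0 \<le> positive_part_approx' j w" "positive_part_approx' j w \<le> 2"
  proof -
    show "0 \<le> positive_part_approx' j w"
    proof (cases "j * w - 1 \<le> 0")
      case False
      then show ?thesis
        using flat0_bounds[of "j * w - 1"] flat1_bounds[of "j * w - 1"]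
        by (auto simp: positive_part_approx'_def intro!: add_nonneg_nonneg mult_nonneg_nonneg)
    qed (simp add: positive_part_approx'_def flat_nonpos)
    show "positive_part_approx' j w \<le> 2"
    proof (cases "j * w - 1 \<le> 0")
      case False
      define y where "y = 1 / (j * w - 1)"
      have y: "y > 0" and jw: "j * w = 1 / y + 1" using False by (auto simp: y_def)
      \<comment> \<open>In terms of \<open>y = 1/(j w - 1)\<close> the bound is \<open>1 + y + y\<^sup>2 \<le> 2 (1 + y + y\<^sup>2/2) \<le> 2 exp y\<close>.\<close>
      have "positive_part_approx' j w = (1 + y + y\<^sup>2) / exp y"
        using False y unfolding positive_part_approx'_def jw
        by (simp add: flat_def exp_minus field_simps power2_eq_square)
      moreover have "1 + y + y\<^sup>2 \<le> 2 * exp y" using exp_quadratic_lower_bound[of y] y by linarith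
      ultimately show ?thesis by (simp add: divide_le_eq)
    qed (simp add: positive_part_approx'_def flat_nonpos)
  qed
qed

lemma flat_limits_at_top:
  "(flat0 \<longlongrightarrow> 1) at_top" "((\<lambda>s. (s + 1) * flat1 s) \<longlongrightarrow> 0) at_top"
proof -
  have "((\<lambda>s::real. exp (- inverse s)) \<longlongrightarrow> exp (- 0)) at_top"
    by (intro tendsto_intros tendsto_inverse_0_at_top filterlim_ident)
  then show "(flat0 \<longlongrightarrow> 1) at_top"
    by (simp, elim Lim_transform_eventually)
       (auto simp: flat_def inverse_eq_divide intro!: eventually_mono[OF eventually_gt_at_top[of 0]])
  have "((\<lambda>s::real. (inverse s + (inverse s)\<^sup>2) * exp (- inverse s)) \<longlongrightarrow> (0 + 0\<^sup>2) * exp (- 0)) at_top"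
    by (intro tendsto_intros tendsto_inverse_0_at_top filterlim_ident)
  then show "((\<lambda>s. (s + 1) * flat1 s) \<longlongrightarrow> 0) at_top"
    by (simp, elim Lim_transform_eventually)
       (auto simp: flat_def inverse_eq_divide field_simps power2_eq_square
         intro!: eventually_mono[OF eventually_gt_at_top[of 0]])
qed

lemma positive_part_approx_limits:
  shows "(\<lambda>i. positive_part_approx (real (Suc i)) w) \<longlonglongrightarrow> max 0 w"
    and "(\<lambda>i. positive_part_approx' (real (Suc i)) w) \<longlonglongrightarrow> (if w > 0 then 1 else 0)"
proof -
  have "(\<lambda>i. positive_part_approx (real (Suc i)) w) \<longlonglongrightarrow> max 0 w \<and>
    (\<lambda>i. positive_part_approx' (real (Suc i)) w) \<longlonglongrightarrow> (if w > 0 then 1 else 0)"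
  proof (cases "w > 0")
    case True
    have "filterlim (\<lambda>i. real (Suc i) * w - 1) at_top sequentially"
      using True by real_asymp
    from flat_limits_at_top[THEN filterlim_compose, OF this]
    have 1: "(\<lambda>i. flat0 (real (Suc i) * w - 1)) \<longlonglongrightarrow> 1"
      and 2: "(\<lambda>i. (real (Suc i) * w) * flat1 (real (Suc i) * w - 1)) \<longlonglongrightarrow> 0"
      by simp_all
    show ?thesis
      using tendsto_mult[OF tendsto_const[of w] 1] tendsto_add[OF 1 2] True
      by (simp add: positive_part_approx_def positive_part_approx'_def)
  next
    case False
    have "positive_part_approx (real (Suc i)) w = 0" "positive_part_approx' (real (Suc i)) w = 0" for i
      using False by (auto intro!: positive_part_approx_support intro: order_trans[of w 0])
    then show ?thesis using False by simp
  qed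
  then show "(\<lambda>i. positive_part_approx (real (Suc i)) w) \<longlonglongrightarrow> max 0 w"
    "(\<lambda>i. positive_part_approx' (real (Suc i)) w) \<longlonglongrightarrow> (if w > 0 then 1 else 0)" by auto
qed

section \<open>A dilation invariant density on the half space\<close>

definition log_norm :: "'a::euclidean_space \<Rightarrow> real" where
  "log_norm x = ln (x \<bullet> x) / 2"

text \<open>
  The measure with this density is invariant under dilations: the density is homogeneous of
  degree \<open>- n\<close>. It is the weight in both limit integrals of the trial functions, since
  \<open>r\<^bsup>-n-2\<^esup>\<close> is the square of the critical power \<open>r\<^bsup>-n/2\<^esup>\<close> divided by \<open>r\<^sup>2\<close>.
\<close>

definition invariant_density :: "'a::euclidean_space \<Rightarrow> 'a \<Rightarrow> real" where
  "invariant_density \<nu> x = (max 0 (x \<bullet> \<nu>))\<^sup>2 * (x \<bullet> x) powr (- (real DIM('a) + 2) / 2)"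

definition annulus :: "real \<Rightarrow> real \<Rightarrow> 'a::euclidean_space set" where
  "annulus a b = {x. a \<le> log_norm x \<and> log_norm x < b}"

lemma log_norm_measurable [measurable]: "log_norm \<in> borel_measurable borel"
  unfolding log_norm_def[abs_def] by measurable

lemma invariant_density_measurable [measurable]: "invariant_density \<nu> \<in> borel_measurable borel"
  unfolding invariant_density_def[abs_def] by measurable

lemma annulus_measurable [measurable]: "annulus a b \<in> sets borel"
  unfolding annulus_def by measurable

lemma invariant_density_nonneg: "0 \<le> invariant_density \<nu> x"
  by (simp add: invariant_density_def)

lemma invariant_density_dilation:
  fixes x :: "'a::euclidean_space"
  assumes "c > 0"
  shows "c ^ DIM('a) * invariant_density \<nu> (c *\<^sub>R x) = invariant_density \<nu> x"
proof -
  let ?n = "real DIM('a)"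
  let ?P = "(x \<bullet> x) powr (- (?n + 2) / 2)"
  have m: "max 0 (c *\<^sub>R x \<bullet> \<nu>) = c * max 0 (x \<bullet> \<nu>)"
    using assms by (simp add: max_def mult_le_0_iff zero_le_mult_iff)
  have q: "(c *\<^sub>R x) \<bullet> (c *\<^sub>R x) = (c powr 2) * (x \<bullet> x)"
    using assms by (simp add: power2_eq_square)
  have e: "(- (2 * ?n) - 4) / 2 = - ?n - 2" by (simp add: field_simps)
  have p: "(c powr 2 * (x \<bullet> x)) powr (- (?n + 2) / 2) = c powr (- (?n + 2)) * ?P"
    using assms by (simp add: powr_mult powr_powr e del: powr_numeral)
  have cn: "c ^ DIM('a) = c powr ?n" using assms by (simp add: powr_realpow)
  have c2: "c\<^sup>2 = c powr 2" using assms by simp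
  have one: "c powr ?n * (c powr 2 * c powr (- (?n + 2))) = 1"
    using assms by (simp add: powr_add[symmetric] del: powr_numeral)
  have "c ^ DIM('a) * invariant_density \<nu> (c *\<^sub>R x)
      = (c powr ?n * (c powr 2 * c powr (- (?n + 2)))) * ((max 0 (x \<bullet> \<nu>))\<^sup>2 * ?P)"
    unfolding invariant_density_def m q p cn power_mult_distrib c2 by (simp only: mult_ac)
  then show ?thesis unfolding one by (simp add: invariant_density_def)
qed

lemma log_norm_dilation:
  assumes "c > 0" "x \<noteq> 0"
  shows "log_norm (c *\<^sub>R x) = ln c + log_norm x"
  using assms by (simp add: log_norm_def ln_mult)

text \<open>
  Dilation by \<open>exp t\<close> translates \<open>log_norm\<close> by \<open>t\<close> and preserves the measure. The origin,
  where \<open>log_norm\<close> is not translated, is harmless because the density is 0 there.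
\<close>

lemma annulus_mass_dilation:
  fixes \<nu> :: "'a::euclidean_space"
  shows "(\<integral>x. invariant_density \<nu> x * indicator (annulus (a + t) (b + t)) x \<partial>lborel) =
         (\<integral>x. invariant_density \<nu> x * indicator (annulus a b) x \<partial>lborel)"
proof -
  have "exp t ^ DIM('a) * (\<integral>x. invariant_density \<nu> (exp t *\<^sub>R x) * indicator (annulus (a + t) (b + t)) (exp t *\<^sub>R x) \<partial>lborel)
      = (\<integral>x. invariant_density \<nu> x * indicator (annulus (a + t) (b + t)) x \<partial>lborel)"
    by (rule integral_dilation_lborel) auto
  moreover have "exp t ^ DIM('a) * (invariant_density \<nu> (exp t *\<^sub>R x) * indicator (annulus (a + t) (b + t)) (exp t *\<^sub>R x))
      = invariant_density \<nu> x * indicator (annulus a b) x" for x :: 'a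
  proof (cases "x = 0")
    case False
    have "indicator (annulus (a + t) (b + t)) (exp t *\<^sub>R x) = (indicator (annulus a b) x :: real)"
      using False by (auto simp: annulus_def log_norm_dilation indicator_def)
    then show ?thesis using invariant_density_dilation[of "exp t" \<nu> x] by (simp add: mult.assoc[symmetric])
  qed (simp add: invariant_density_def)
  ultimately show ?thesis
    by (simp flip: integral_mult_right_zero)
qed

lemma log_norm_bounds:
  assumes "x \<noteq> 0"
  shows "log_norm x < b \<Longrightarrow> norm x < exp b" "0 \<le> log_norm x \<Longrightarrow> 1 \<le> norm x"
    and "log_norm x = ln (norm x)"
proof -
  have "ln ((norm x)\<^sup>2) = 2 * ln (norm x)"
    using assms by (subst ln_realpow) auto
  then show L: "log_norm x = ln (norm x)"
    by (simp add: log_norm_def power2_norm_eq_inner[symmetric])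
  show "log_norm x < b \<Longrightarrow> norm x < exp b"
    using assms unfolding L by (metis exp_less_mono exp_ln zero_less_norm_iff)
  show "0 \<le> log_norm x \<Longrightarrow> 1 \<le> norm x"
    using assms unfolding L by simp
qed

lemma invariant_density_le_1:
  fixes x :: "'a::euclidean_space"
  assumes "norm \<nu> = 1" "0 \<le> log_norm x"
  shows "invariant_density \<nu> x \<le> 1"
proof (cases "x = 0")
  case False
  have r: "1 \<le> norm x" using log_norm_bounds(2)[OF False assms(2)] .
  have "max 0 (x \<bullet> \<nu>) \<le> norm x"
    using norm_cauchy_schwarz[of x \<nu>] assms(1) by simp
  then have "(max 0 (x \<bullet> \<nu>))\<^sup>2 \<le> x \<bullet> x"
    unfolding power2_norm_eq_inner[symmetric] by (intro power_mono) auto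
  then have "invariant_density \<nu> x \<le> (x \<bullet> x) powr 1 * (x \<bullet> x) powr (- (real DIM('a) + 2) / 2)"
    unfolding invariant_density_def by (intro mult_right_mono) auto
  also have "\<dots> = (x \<bullet> x) powr (- (real DIM('a) / 2))"
    unfolding powr_add[symmetric] by (simp add: field_simps)
  also have "\<dots> \<le> (x \<bullet> x) powr 0"
    using r by (intro powr_mono) (auto simp: power2_norm_eq_inner[symmetric])
  finally show ?thesis by (simp split: if_splits)
qed (simp add: invariant_density_def)

lemma integrable_annulus_mass:
  fixes \<nu> :: "'a::euclidean_space"
  assumes "norm \<nu> = 1" "0 \<le> a"
  shows "integrable lborel (\<lambda>x. invariant_density \<nu> x * indicator (annulus a b) x)"
proof (rule Bochner_Integration.integrable_bound)
  show "integrable lborel (\<lambda>x. indicator (cball (0::'a) (exp b)) x *\<^sub>R (1::real))"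
    by (rule borel_integrable_compact) auto
  show "AE x in lborel. norm (invariant_density \<nu> x * indicator (annulus a b) x)
      \<le> norm (indicator (cball (0::'a) (exp b)) x *\<^sub>R (1::real))"
  proof (intro always_eventually allI)
    fix x :: 'a
    show "norm (invariant_density \<nu> x * indicator (annulus a b) x)
      \<le> norm (indicator (cball (0::'a) (exp b)) x *\<^sub>R (1::real))"
    proof (cases "x \<in> annulus a b")
      case True
      then have "0 \<le> log_norm x" "log_norm x < b" using assms(2) by (auto simp: annulus_def)
      moreover have "norm x \<le> exp b"
        using log_norm_bounds(1)[of x b] \<open>log_norm x < b\<close> by (cases "x = 0") auto
      ultimately show ?thesis
        using invariant_density_le_1[OF assms(1), of x] invariant_density_nonneg[of \<nu> x] True by simp
    qed simp
  qed
qed auto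

lemma annulus_mass_pos:
  fixes \<nu> :: "'a::euclidean_space"
  assumes "norm \<nu> = 1" "0 \<le> a" "a < b"
  shows "0 < (\<integral>x. invariant_density \<nu> x * indicator (annulus a b) x \<partial>lborel)"
proof (rule ccontr)
  let ?f = "\<lambda>x. invariant_density \<nu> x * indicator (annulus a b) x :: real"
  assume "\<not> ?thesis"
  moreover have "0 \<le> (\<integral>x. ?f x \<partial>lborel)"
    by (intro integral_nonneg_AE always_eventually allI mult_nonneg_nonneg invariant_density_nonneg) auto
  ultimately have "(\<integral>x. ?f x \<partial>lborel) = 0" by linarith
  then have "AE x in lborel. ?f x = 0"
    by (subst (asm) integral_nonneg_eq_0_iff_AE[OF integrable_annulus_mass[OF assms(1,2)]])
       (auto intro!: always_eventually mult_nonneg_nonneg invariant_density_nonneg)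
  define S where "S = {x. x \<bullet> \<nu> > 0 \<and> exp a < norm x \<and> norm x < exp b}"
  have "open S"
    unfolding S_def by (intro open_Collect_conj open_Collect_less continuous_intros)
  have "?f x \<noteq> 0" if "x \<in> S" for x
  proof -
    have x0: "x \<noteq> 0" using that by (auto simp: S_def)
    have "ln (exp a) < ln (norm x)" "ln (norm x) < ln (exp b)"
      using that x0 by (auto simp: S_def simp del: ln_exp)
    then have "x \<in> annulus a b"
      by (auto simp: annulus_def log_norm_bounds(3)[OF x0])
    moreover have "invariant_density \<nu> x > 0"
      using that x0 by (simp add: invariant_density_def S_def)
    ultimately show ?thesis by simp
  qed
  with \<open>AE x in lborel. ?f x = 0\<close> have "AE x in lborel. x \<notin> S"
    by (auto elim!: eventually_mono)
  then have "AE x in lebesgue. x \<notin> S" by (rule AE_completion)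
  then have "negligible S"
    using negligible_iff_null_sets AE_iff_null_sets[of S lebesgue] \<open>open S\<close>
    by (metis borel_open lborelD sets_completionI_sets sets_lborel)
  then have empty: "S = {}" using open_not_negligible[OF \<open>open S\<close>] by blast
  obtain c where "exp a < c" "c < exp b"
    using dense[of "exp a" "exp b"] assms(3) by auto
  moreover from this have "c > 0" using exp_gt_zero[of a] by linarith
  moreover have "\<nu> \<bullet> \<nu> = 1" using assms(1) by (simp add: norm_eq_1)
  ultimately have "c *\<^sub>R \<nu> \<in> S"
    using assms(1) by (simp add: S_def)
  with empty show False by blast
qed

section \<open>Radial profiles with almost critical Hardy quotient\<close>

text \<open>
  The critical power \<open>r\<^bsup>-n/2\<^esup>\<close>, cut off at a logarithmic scale of length \<open>3 / \<epsilon>\<close>. At the origin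
  \<open>log_norm\<close> has the value 0 (as \<open>ln 0 = 0\<close>), where the bump vanishes.
\<close>

definition radial_profile :: "real \<Rightarrow> 'a::euclidean_space \<Rightarrow> real" where
  "radial_profile \<epsilon> x = (x \<bullet> x) powr (- real DIM('a) / 4) * bump (\<epsilon> * log_norm x)"

definition radial_profile_grad :: "real \<Rightarrow> 'a::euclidean_space \<Rightarrow> 'a" where
  "radial_profile_grad \<epsilon> x =
     ((x \<bullet> x) powr (- real DIM('a) / 4 - 1) *
       (\<epsilon> * bump' (\<epsilon> * log_norm x) - real DIM('a) / 2 * bump (\<epsilon> * log_norm x))) *\<^sub>R x"

definition shell :: "real \<Rightarrow> 'a::euclidean_space set" where
  "shell \<epsilon> = {x. 1 \<le> norm x \<and> norm x \<le> exp (3 / \<epsilon>)}"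

lemma compact_shell: "compact (shell \<epsilon> :: 'a::euclidean_space set)"
proof -
  have "shell \<epsilon> = (cball 0 (exp (3 / \<epsilon>)) - ball 0 1 :: 'a set)" by (auto simp: shell_def)
  then show ?thesis by (simp add: compact_diff)
qed

lemma zero_not_in_shell: "0 \<notin> shell \<epsilon>"
  by (simp add: shell_def)

lemma bump_log_norm_off_shell:
  assumes "\<epsilon> > 0" "x \<notin> shell \<epsilon>"
  shows "bump (\<epsilon> * log_norm x) = 0 \<and> bump' (\<epsilon> * log_norm x) = 0"
proof -
  have "\<epsilon> * log_norm x \<le> 0 \<or> 3 \<le> \<epsilon> * log_norm x"
  proof (cases "x = 0")
    case False
    consider "norm x < 1" | "exp (3 / \<epsilon>) < norm x" using assms(2) by (auto simp: shell_def)
    then show ?thesis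
    proof cases
      case 1
      then have "log_norm x \<le> 0" using False by (simp add: log_norm_bounds(3))
      then show ?thesis using assms(1) by (simp add: mult_le_0_iff)
    next
      case 2
      then have "ln (exp (3 / \<epsilon>)) < ln (norm x)"
        using False by (simp del: ln_exp)
      then have "3 / \<epsilon> < log_norm x"
        using False by (simp add: log_norm_bounds(3))
      then show ?thesis using assms(1) by (simp add: field_simps)
    qed
  qed (simp add: log_norm_def)
  then show ?thesis using bump_support by blast
qed

lemma radial_profile_off_shell:
  assumes "\<epsilon> > 0" "x \<notin> shell \<epsilon>"
  shows "radial_profile \<epsilon> x = 0" "radial_profile_grad \<epsilon> x = 0"
  using bump_log_norm_off_shell[OF assms] by (auto simp: radial_profile_def radial_profile_grad_def)

lemma log_norm_has_derivative:
  fixes x :: "'a::euclidean_space"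
  assumes "x \<noteq> 0"
  shows "(log_norm has_derivative (\<lambda>v. (x \<bullet> v) / (x \<bullet> x))) (at x)"
proof -
  have pos: "x \<bullet> x > 0" using assms by simp
  have "((\<lambda>x. x \<bullet> x) has_derivative (\<lambda>v. 2 * (x \<bullet> v))) (at x)"
    by (auto intro!: derivative_eq_intros simp: inner_commute)
  then have "((\<lambda>x. ln (x \<bullet> x)) has_derivative (\<lambda>v. (2 * (x \<bullet> v)) * inverse (x \<bullet> x))) (at x)"
    by (intro has_derivative_ln pos)
  then have "((\<lambda>x. ln (x \<bullet> x) * (1 / 2)) has_derivative (\<lambda>v. (2 * (x \<bullet> v)) * inverse (x \<bullet> x) * (1 / 2))) (at x)"
    by (rule has_derivative_mult_left)
  moreover have "log_norm = (\<lambda>x::'a. ln (x \<bullet> x) * (1 / 2))"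
    by (simp add: log_norm_def fun_eq_iff)
  moreover have "2 * s * inverse q * (1 / 2) = s / q" for s q :: real
    by (simp add: field_simps)
  ultimately show ?thesis by (simp only:)
qed

lemma radial_profile_has_derivative:
  fixes x :: "'a::euclidean_space"
  assumes "\<epsilon> > 0"
  shows "(radial_profile \<epsilon> has_derivative (\<lambda>v. radial_profile_grad \<epsilon> x \<bullet> v)) (at x)"
proof (cases "x = 0")
  case False
  define a where "a = - real DIM('a) / 4"
  have n: "real DIM('a) / 2 = - (2 * a)" by (simp add: a_def)
  let ?q = "x \<bullet> x" let ?L = "log_norm x"
  have pos: "?q > 0" using False by simp
  have P: "((\<lambda>x. (x \<bullet> x) powr a) has_derivative (\<lambda>v. ((2 * a * ?q powr (a - 1)) *\<^sub>R x) \<bullet> v)) (at x)"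
    using has_laplacian_on_radial_power[of "{x}" a, unfolded has_laplacian_on_def] False
    by blast
  have B: "((\<lambda>x. bump (\<epsilon> * log_norm x)) has_derivative (\<lambda>v. bump' (\<epsilon> * ?L) * (\<epsilon> * ((x \<bullet> v) / ?q)))) (at x)"
    using has_derivative_compose[OF has_derivative_mult_right[OF log_norm_has_derivative[OF False], of \<epsilon>]
        bump_has_derivative[unfolded has_field_derivative_def]] by simp
  have pw: "?q powr a = ?q powr (a - 1) * ?q"
    using pos powr_add[of ?q "a - 1" 1] by simp
  have key: "?q powr a * (bump' (\<epsilon> * ?L) * (\<epsilon> * ((x \<bullet> v) / ?q))) = ?q powr (a - 1) * (\<epsilon> * bump' (\<epsilon> * ?L)) * (x \<bullet> v)" for v
    unfolding pw using pos by simp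
  show ?thesis
    unfolding radial_profile_def[abs_def] radial_profile_grad_def n a_def[symmetric]
    by (rule has_derivative_eq_rhs[OF has_derivative_mult[OF P B]], rule ext,
        simp only: key inner_scaleR_left, algebra)
next
  case True
  have zero: "0 = radial_profile \<epsilon> y" if "y \<in> ball 0 1" for y :: 'a
    using that radial_profile_off_shell(1)[OF assms, of y] by (simp add: shell_def)
  have grad: "radial_profile_grad \<epsilon> x = 0"
    by (simp add: True radial_profile_grad_def)
  show ?thesis
    unfolding grad
  proof (rule has_derivative_transform_within_open)
    show "((\<lambda>_. 0) has_derivative (\<lambda>v. 0 \<bullet> v)) (at x)" by simp
    show "open (ball 0 1 :: 'a set)" "x \<in> ball 0 1" using True by auto
  qed (rule zero)
qed

lemma continuous_radial_profile:
  assumes "\<epsilon> > 0"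
  shows "continuous_on UNIV (radial_profile \<epsilon> :: 'a::euclidean_space \<Rightarrow> real)"
    and "continuous_on UNIV (radial_profile_grad \<epsilon> :: 'a \<Rightarrow> 'a)"
proof -
  show "continuous_on UNIV (radial_profile \<epsilon> :: 'a \<Rightarrow> real)"
    by (intro continuous_at_imp_continuous_on ballI
        has_derivative_continuous[OF radial_profile_has_derivative[OF assms]])
  have L: "continuous_on {x::'a. x \<noteq> 0} log_norm"
    unfolding log_norm_def[abs_def] by (intro continuous_intros) auto
  have "continuous_on {x::'a. x \<noteq> 0} (radial_profile_grad \<epsilon>)"
    unfolding radial_profile_grad_def[abs_def]
    by (intro continuous_intros L continuous_on_compose2[OF continuous_on_bump(1)[of UNIV]]
        continuous_on_compose2[OF continuous_on_bump(2)[of UNIV]]) auto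
  then show "continuous_on UNIV (radial_profile_grad \<epsilon> :: 'a \<Rightarrow> 'a)"
    by (rule continuous_on_zero_off_compact[OF _ _ compact_shell[of \<epsilon>]])
       (use zero_not_in_shell radial_profile_off_shell(2)[OF assms] in \<open>auto intro!: open_Collect_neq\<close>)
qed

lemma critical_powers:
  fixes q n :: real
  assumes "q > 0"
  shows "(q powr (- n / 4))\<^sup>2 / q = q powr (- (n + 2) / 2)"
    and "(q powr (- n / 4 - 1))\<^sup>2 * q = q powr (- (n + 2) / 2)"
proof -
  have sq: "(q powr a)\<^sup>2 = q powr (2 * a)" for a
    unfolding power2_eq_square powr_add[symmetric] mult_2 ..
  have e1: "- (n + 2) / 2 + 1 = 2 * (- n / 4)" and e2: "2 * (- n / 4 - 1) + 1 = - (n + 2) / 2"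
    by (simp_all add: field_simps)
  have "q powr (- (n + 2) / 2) * q powr 1 = q powr (2 * (- n / 4))"
    unfolding powr_add[symmetric] e1 ..
  then show "(q powr (- n / 4))\<^sup>2 / q = q powr (- (n + 2) / 2)"
    unfolding sq using assms by (simp add: divide_eq_eq)
  have "q powr (2 * (- n / 4 - 1)) * q powr 1 = q powr (- (n + 2) / 2)"
    unfolding powr_add[symmetric] e2 ..
  then show "(q powr (- n / 4 - 1))\<^sup>2 * q = q powr (- (n + 2) / 2)"
    unfolding sq using assms by simp
qed

lemma weighted_radial_profile:
  fixes x \<nu> :: "'a::euclidean_space"
  shows "(max 0 (x \<bullet> \<nu>))\<^sup>2 * (radial_profile \<epsilon> x)\<^sup>2 / (norm x)\<^sup>2 =
      invariant_density \<nu> x * (bump (\<epsilon> * log_norm x))\<^sup>2" (is ?A)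
    and "(max 0 (x \<bullet> \<nu>))\<^sup>2 * (norm (radial_profile_grad \<epsilon> x))\<^sup>2 = invariant_density \<nu> x *
      (\<epsilon> * bump' (\<epsilon> * log_norm x) - real DIM('a) / 2 * bump (\<epsilon> * log_norm x))\<^sup>2" (is ?B)
proof -
  have "?A \<and> ?B"
  proof (cases "x = 0")
    case True
    have "max 0 (x \<bullet> \<nu>) = 0" using True by simp
    then have "invariant_density \<nu> x = 0" unfolding invariant_density_def by simp
    then show ?thesis unfolding \<open>max 0 (x \<bullet> \<nu>) = 0\<close> by simp
  next
    case False
    let ?n = "real DIM('a)" and ?q = "x \<bullet> x" and ?w = "(max 0 (x \<bullet> \<nu>))\<^sup>2"
    have pos: "?q > 0" using False by simp
    have "?w * (radial_profile \<epsilon> x)\<^sup>2 / (norm x)\<^sup>2 =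
        ?w * ((?q powr (- ?n / 4))\<^sup>2 / ?q) * (bump (\<epsilon> * log_norm x))\<^sup>2"
      unfolding radial_profile_def power2_norm_eq_inner power_mult_distrib
      by (simp only: times_divide_eq_left times_divide_eq_right mult_ac)
    moreover have "?w * (norm (radial_profile_grad \<epsilon> x))\<^sup>2 = ?w * ((?q powr (- ?n / 4 - 1))\<^sup>2 * ?q) *
        (\<epsilon> * bump' (\<epsilon> * log_norm x) - ?n / 2 * bump (\<epsilon> * log_norm x))\<^sup>2"
      unfolding radial_profile_grad_def norm_scaleR power_mult_distrib power2_abs power2_norm_eq_inner[of x]
      by (simp only: mult_ac)
    ultimately show ?thesis
      unfolding critical_powers[OF pos] invariant_density_def by (rule conjI)
  qed
  then show ?A and ?B by (rule conjunct1, rule conjunct2)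
qed

text \<open>
  In terms of \<open>t = log_norm x\<close> the two integrands are \<open>(\<epsilon> \<zeta>'(\<epsilon> t) - (n/2) \<zeta>(\<epsilon> t))\<^sup>2\<close> and
  \<open>\<zeta>(\<epsilon> t)\<^sup>2\<close>, for the bump \<open>\<zeta>\<close>, against the invariant measure. The terms with \<open>\<zeta>'\<close> are at most
  \<open>\<epsilon> (2 n + 4)\<close> on three annuli of equal mass \<open>m\<close>, whereas the second integral is at least
  \<open>exp (- 4) m\<close>, from the middle annulus alone. So the quotient is \<open>n\<^sup>2/4 + O(\<epsilon>)\<close>.
\<close>

lemma almost_critical_profile:
  fixes \<nu> :: "'a::euclidean_space"
  assumes \<nu>: "norm \<nu> = 1" and C: "C > (real DIM('a))\<^sup>2 / 4"
  obtains \<epsilon> where "\<epsilon> > 0"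
    "(\<integral>x. (max 0 (x \<bullet> \<nu>))\<^sup>2 * (norm (radial_profile_grad \<epsilon> x))\<^sup>2 \<partial>lborel)
       < C * (\<integral>x. (max 0 (x \<bullet> \<nu>))\<^sup>2 * (radial_profile \<epsilon> x)\<^sup>2 / (norm x)\<^sup>2 \<partial>lborel)"
proof -
  let ?n = "real DIM('a)"
  \<comment> \<open>The quotient is at most \<open>n\<^sup>2/4 + \<epsilon> K\<close>.\<close>
  define K where "K = 3 * exp 4 * (2 * ?n + 4)"
  have K: "K > 0" unfolding K_def by (intro mult_pos_pos) auto
  define \<epsilon> where "\<epsilon> = min 1 ((C - ?n\<^sup>2 / 4) / (2 * K))"
  have \<epsilon>: "0 < \<epsilon>" "\<epsilon> \<le> 1" using C K by (auto simp: \<epsilon>_def)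
  have "\<epsilon> \<le> (C - ?n\<^sup>2 / 4) / (2 * K)" by (simp add: \<epsilon>_def)
  then have "\<epsilon> * K \<le> (C - ?n\<^sup>2 / 4) / 2" using K by (simp add: field_simps)
  then have \<epsilon>K: "?n\<^sup>2 / 4 + \<epsilon> * K < C" using C by simp
  define T where "T = 1 / \<epsilon>"
  have T: "T > 0" using \<epsilon> by (simp add: T_def)
  let ?M = "invariant_density \<nu>"
  let ?z = "\<lambda>x::'a. bump (\<epsilon> * log_norm x)" and ?z' = "\<lambda>x::'a. bump' (\<epsilon> * log_norm x)"
  define m where "m = (\<integral>x. ?M x * indicator (annulus 0 T) x \<partial>lborel)"
  define V where "V = (\<integral>x. ?M x * (?z x)\<^sup>2 \<partial>lborel)"
  have m1: "(\<integral>x. ?M x * indicator (annulus T (2 * T)) x \<partial>lborel) = m"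
    using annulus_mass_dilation[of \<nu> 0 T T] by (simp add: m_def)
  have m2: "(\<integral>x. ?M x * indicator (annulus (2 * T) (3 * T)) x \<partial>lborel) = m"
    using annulus_mass_dilation[of \<nu> 0 "2 * T" T] by (simp add: m_def)
  have m: "m > 0" unfolding m_def using annulus_mass_pos[OF \<nu> _ T] by simp
  have i: "integrable lborel (\<lambda>x. ?M x * indicator (annulus a b) x)" if "0 \<le> a" for a b
    by (rule integrable_annulus_mass[OF \<nu> that])
  have "annulus 0 (3 * T) = annulus 0 T \<union> annulus T (2 * T) \<union> (annulus (2 * T) (3 * T) :: 'a set)"
    using T by (auto simp: annulus_def)
  then have split: "?M x * indicator (annulus 0 (3 * T)) x = ?M x * indicator (annulus 0 T) x
      + ?M x * indicator (annulus T (2 * T)) x + ?M x * indicator (annulus (2 * T) (3 * T)) x" for x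
    by (auto simp: indicator_def annulus_def)
  have m3: "(\<integral>x. ?M x * indicator (annulus 0 (3 * T)) x \<partial>lborel) = 3 * m"
    unfolding split using i[of 0 T] i[of T "2 * T"] i[of "2 * T" "3 * T"] T m1 m2
    by (simp add: m_def)
  have z0: "?z x = 0" "?z' x = 0" if "x \<notin> annulus 0 (3 * T)" for x :: 'a
  proof -
    have "\<epsilon> * log_norm x \<le> 0 \<or> 3 \<le> \<epsilon> * log_norm x"
      using that \<epsilon> by (auto simp: annulus_def T_def field_simps mult_le_0_iff)
    then show "?z x = 0" "?z' x = 0" using bump_support by blast+
  qed
  have [measurable]: "bump \<in> borel_measurable borel" "bump' \<in> borel_measurable borel"
    using continuous_on_bump by (auto intro!: borel_measurable_continuous_onI)
  have Vi: "integrable lborel (\<lambda>x. ?M x * (?z x)\<^sup>2)"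
  proof (rule Bochner_Integration.integrable_bound[OF i[of 0 "3 * T"]])
    show "AE x in lborel. norm (?M x * (?z x)\<^sup>2) \<le> norm (?M x * indicator (annulus 0 (3 * T)) x)"
    proof (intro always_eventually allI)
      fix x :: 'a
      have "(?z x)\<^sup>2 \<le> indicator (annulus 0 (3 * T)) x"
        using z0(1)[of x] bump_bounds(1,2)[of "\<epsilon> * log_norm x"]
        by (cases "x \<in> annulus 0 (3 * T)") (auto simp: power_le_one)
      then show "norm (?M x * (?z x)\<^sup>2) \<le> norm (?M x * indicator (annulus 0 (3 * T)) x)"
        using invariant_density_nonneg[of \<nu> x] by (auto simp: abs_mult intro!: mult_left_mono)
    qed
  qed auto
  have "exp (- 4) * m \<le> V"
  proof -
    have "(\<integral>x. exp (- 4) * (?M x * indicator (annulus T (2 * T)) x) \<partial>lborel) \<le> V"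
      unfolding V_def
    proof (rule integral_mono[OF _ Vi])
      fix x :: 'a
      show "exp (- 4) * (?M x * indicator (annulus T (2 * T)) x) \<le> ?M x * (?z x)\<^sup>2"
      proof (cases "x \<in> annulus T (2 * T)")
        case True
        then have "1 \<le> \<epsilon> * log_norm x" "\<epsilon> * log_norm x \<le> 2"
          using \<epsilon> by (auto simp: annulus_def T_def field_simps)
        then have "(exp (- 2))\<^sup>2 \<le> (?z x)\<^sup>2" using bump_ge by (intro power_mono) auto
        then have "exp (- 4) \<le> (?z x)\<^sup>2" by (simp add: power2_eq_square exp_add[symmetric])
        then have "?M x * exp (- 4) \<le> ?M x * (?z x)\<^sup>2"
          using invariant_density_nonneg by (intro mult_left_mono) auto
        then show ?thesis using True by (simp add: mult.commute)
      qed (simp add: invariant_density_nonneg)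
    qed (use i[of T] T in auto)
    then show ?thesis using m1 by simp
  qed
  then have mV: "m \<le> exp 4 * V" by (simp add: exp_minus field_simps)
  have V: "V > 0" using \<open>exp (- 4) * m \<le> V\<close> m by (smt (verit) exp_gt_zero mult_pos_pos)
  have "(\<integral>x. ?M x * (\<epsilon> * ?z' x - ?n / 2 * ?z x)\<^sup>2 \<partial>lborel)
     \<le> (\<integral>x. ?n\<^sup>2 / 4 * (?M x * (?z x)\<^sup>2) + (\<epsilon> * (2 * ?n + 4)) * (?M x * indicator (annulus 0 (3 * T)) x) \<partial>lborel)"
  proof (rule integral_mono')
    show "integrable lborel (\<lambda>x. ?n\<^sup>2 / 4 * (?M x * (?z x)\<^sup>2) + (\<epsilon> * (2 * ?n + 4)) * (?M x * indicator (annulus 0 (3 * T)) x))"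
      using Vi i[of 0] by auto
    fix x :: 'a
    show "0 \<le> ?n\<^sup>2 / 4 * (?M x * (?z x)\<^sup>2) + (\<epsilon> * (2 * ?n + 4)) * (?M x * indicator (annulus 0 (3 * T)) x)"
      using invariant_density_nonneg[of \<nu> x] \<epsilon> by (intro add_nonneg_nonneg mult_nonneg_nonneg) auto
    have "(\<epsilon> * ?z' x - ?n / 2 * ?z x)\<^sup>2 \<le> ?n\<^sup>2 / 4 * (?z x)\<^sup>2 + \<epsilon> * (2 * ?n + 4) * indicator (annulus 0 (3 * T)) x"
    proof (cases "x \<in> annulus 0 (3 * T)")
      case True
      note b = bump_bounds[of "\<epsilon> * log_norm x"]
      have "\<bar>?z x * ?z' x\<bar> \<le> 1 * 2"
        using b unfolding abs_mult by (intro mult_mono) auto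
      then have "\<epsilon> * ?n * (- (?z x * ?z' x)) \<le> \<epsilon> * ?n * 2"
        using \<epsilon> by (intro mult_left_mono) auto
      moreover have "\<bar>?z' x\<bar>\<^sup>2 \<le> 2\<^sup>2" using b by (intro power_mono) auto
      then have "\<epsilon> * \<epsilon> * (?z' x)\<^sup>2 \<le> \<epsilon> * 1 * 4"
        using \<epsilon> by (intro mult_mono) auto
      moreover have "(\<epsilon> * ?z' x - ?n / 2 * ?z x)\<^sup>2
          = ?n\<^sup>2 / 4 * (?z x)\<^sup>2 + \<epsilon> * ?n * (- (?z x * ?z' x)) + \<epsilon> * \<epsilon> * (?z' x)\<^sup>2"
        by (simp add: power2_eq_square field_simps)
      moreover have "\<epsilon> * (2 * ?n + 4) * indicator (annulus 0 (3 * T)) x = \<epsilon> * ?n * 2 + \<epsilon> * 1 * 4"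
        using True by (simp add: algebra_simps)
      ultimately show ?thesis by linarith
    next
      case False
      then have "?z x = 0" "?z' x = 0" using z0 by auto
      then show ?thesis using False by simp
    qed
    then have "?M x * (\<epsilon> * ?z' x - ?n / 2 * ?z x)\<^sup>2 \<le> ?M x * (?n\<^sup>2 / 4 * (?z x)\<^sup>2 + \<epsilon> * (2 * ?n + 4) * indicator (annulus 0 (3 * T)) x)"
      by (intro mult_left_mono invariant_density_nonneg)
    then show "?M x * (\<epsilon> * ?z' x - ?n / 2 * ?z x)\<^sup>2 \<le> ?n\<^sup>2 / 4 * (?M x * (?z x)\<^sup>2) + (\<epsilon> * (2 * ?n + 4)) * (?M x * indicator (annulus 0 (3 * T)) x)"
      by (simp add: algebra_simps)
  qed
  also have "\<dots> = ?n\<^sup>2 / 4 * V + \<epsilon> * (2 * ?n + 4) * (3 * m)"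
    using Vi i[of 0 "3 * T"] unfolding m3[symmetric] V_def by simp
  also have "\<epsilon> * (2 * ?n + 4) * (3 * m) \<le> \<epsilon> * (2 * ?n + 4) * (3 * (exp 4 * V))"
    using mV \<epsilon> by (intro mult_left_mono) auto
  also have "\<epsilon> * (2 * ?n + 4) * (3 * (exp 4 * V)) = \<epsilon> * K * V"
    by (simp add: K_def)
  also have "?n\<^sup>2 / 4 * V + \<epsilon> * K * V = (?n\<^sup>2 / 4 + \<epsilon> * K) * V" by (simp add: algebra_simps)
  also have "\<dots> < C * V" using \<epsilon>K V by (intro mult_strict_right_mono) auto
  finally show thesis
    using that[OF \<epsilon>(1)] unfolding weighted_radial_profile V_def by simp
qed

section \<open>Trial functions on the half space\<close>

definition trial :: "'a::euclidean_space \<Rightarrow> real \<Rightarrow> real \<Rightarrow> 'a \<Rightarrow> real" where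
  "trial \<nu> \<epsilon> j x = positive_part_approx j (x \<bullet> \<nu>) * radial_profile \<epsilon> x"

definition trial_grad :: "'a::euclidean_space \<Rightarrow> real \<Rightarrow> real \<Rightarrow> 'a \<Rightarrow> 'a" where
  "trial_grad \<nu> \<epsilon> j x = (positive_part_approx' j (x \<bullet> \<nu>) * radial_profile \<epsilon> x) *\<^sub>R \<nu> +
     positive_part_approx j (x \<bullet> \<nu>) *\<^sub>R radial_profile_grad \<epsilon> x"

lemma positive_part_approx_inner_has_derivative:
  fixes \<nu> :: "'a::euclidean_space"
  shows "((\<lambda>x. positive_part_approx j (x \<bullet> \<nu>)) has_derivative
     (\<lambda>v. positive_part_approx' j (x \<bullet> \<nu>) * (v \<bullet> \<nu>))) (at x)"
proof -
  have "((\<lambda>x. x \<bullet> \<nu>) has_derivative (\<lambda>v. v \<bullet> \<nu>)) (at x)"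
    by (auto intro!: derivative_eq_intros)
  then show ?thesis
    by (rule has_derivative_compose[OF _ positive_part_approx_has_derivative[unfolded has_field_derivative_def]])
qed

lemma trial_has_derivative:
  assumes "\<epsilon> > 0"
  shows "(trial \<nu> \<epsilon> j has_derivative (\<lambda>v. trial_grad \<nu> \<epsilon> j x \<bullet> v)) (at x)"
proof -
  have "(\<lambda>v. trial_grad \<nu> \<epsilon> j x \<bullet> v) = (\<lambda>v. positive_part_approx j (x \<bullet> \<nu>) * (radial_profile_grad \<epsilon> x \<bullet> v) +
      positive_part_approx' j (x \<bullet> \<nu>) * (v \<bullet> \<nu>) * radial_profile \<epsilon> x)"
    by (simp add: fun_eq_iff trial_grad_def inner_add_left inner_commute[of \<nu>])
  then show ?thesis
    using has_derivative_mult[OF positive_part_approx_inner_has_derivative radial_profile_has_derivative[OF assms]]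
    unfolding trial_def[abs_def] by (simp only:)
qed

lemma continuous_positive_part_approx:
  fixes \<nu> :: "'a::euclidean_space"
  shows "continuous_on UNIV (\<lambda>x. positive_part_approx j (x \<bullet> \<nu>))"
    and "continuous_on UNIV (\<lambda>x. positive_part_approx' j (x \<bullet> \<nu>))"
  unfolding positive_part_approx_def positive_part_approx'_def
  by (intro continuous_intros continuous_on_compose2[OF continuous_on_flat[of UNIV]]; simp)+

lemma continuous_trial:
  fixes \<nu> :: "'a::euclidean_space"
  assumes "\<epsilon> > 0"
  shows "continuous_on UNIV (trial \<nu> \<epsilon> j)" "continuous_on UNIV (trial_grad \<nu> \<epsilon> j)"
  unfolding trial_def[abs_def] trial_grad_def[abs_def]
  by (intro continuous_on_add continuous_on_mult continuous_on_scaleR continuous_on_const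
      continuous_positive_part_approx continuous_radial_profile assms)+

text \<open>
  Writing \<open>Q\<close> for the profile, the derivative of \<open>p Q\<^sup>2\<close> in the direction \<open>\<nu>\<close> integrates to 0. It is
  subtracted here so that every term except \<open>p\<^sup>2 |\<nabla>Q|\<^sup>2\<close> carries a factor \<open>p'\<^sup>2 - p'\<close> or \<open>p (p' - 1)\<close>;
  these factors tend to 0, since in the limit \<open>p'\<close> is 0 or 1 and \<open>p = 0\<close> where \<open>p' = 0\<close>.
\<close>

lemma trial_gradient_square_integral:
  fixes \<nu> :: "'a::euclidean_space"
  assumes \<epsilon>: "\<epsilon> > 0" and \<nu>: "norm \<nu> = 1"
  shows "(\<integral>x. (norm (trial_grad \<nu> \<epsilon> j x))\<^sup>2 \<partial>lborel) =
    (\<integral>x. ((positive_part_approx' j (x \<bullet> \<nu>))\<^sup>2 - positive_part_approx' j (x \<bullet> \<nu>)) * (radial_profile \<epsilon> x)\<^sup>2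
      + 2 * positive_part_approx j (x \<bullet> \<nu>) * (positive_part_approx' j (x \<bullet> \<nu>) - 1)
          * radial_profile \<epsilon> x * (radial_profile_grad \<epsilon> x \<bullet> \<nu>)
      + (positive_part_approx j (x \<bullet> \<nu>))\<^sup>2 * (norm (radial_profile_grad \<epsilon> x))\<^sup>2 \<partial>lborel)"
proof -
  let ?p = "\<lambda>x. positive_part_approx j (x \<bullet> \<nu>)" and ?p' = "\<lambda>x. positive_part_approx' j (x \<bullet> \<nu>)"
  let ?Q = "radial_profile \<epsilon> :: 'a \<Rightarrow> real" and ?G = "radial_profile_grad \<epsilon> :: 'a \<Rightarrow> 'a"
  note cont = continuous_positive_part_approx continuous_radial_profile[OF \<epsilon>]
  have nn: "\<nu> \<bullet> \<nu> = 1" using \<nu> by (simp add: norm_eq_1)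
  define d where "d x = ?p' x * (?Q x)\<^sup>2 + 2 * ?p x * ?Q x * (?G x \<bullet> \<nu>)" for x
  have cd: "continuous_on UNIV d"
    unfolding d_def[abs_def] by (intro continuous_intros cont)
  have cg: "continuous_on UNIV (\<lambda>x. ?p x * (?Q x)\<^sup>2)"
    by (intro continuous_intros cont)
  have zero: "?Q x = 0" "?G x = 0" if "x \<notin> shell \<epsilon>" for x
    using radial_profile_off_shell[OF \<epsilon> that] by auto
  have "(\<integral>x. d x \<partial>lborel) = 0"
  proof (rule integral_directional_derivative_eq_0[OF cg cd _ compact_shell[of \<epsilon>], of \<nu>])
    fix x :: 'a
    have lin: "((\<lambda>t. x + t *\<^sub>R \<nu>) has_derivative (\<lambda>t. t *\<^sub>R \<nu>)) (at 0)"
      by (auto intro!: derivative_eq_intros)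
    have comp: "((\<lambda>t. f (x + t *\<^sub>R \<nu>)) has_derivative (\<lambda>t. f' (t *\<^sub>R \<nu>))) (at 0)"
      if "(f has_derivative f') (at x)" for f :: "'a \<Rightarrow> real" and f'
      using has_derivative_compose[OF lin, of f f'] that by simp
    have 1: "((\<lambda>t. ?p (x + t *\<^sub>R \<nu>)) has_real_derivative ?p' x) (at 0)"
      using comp[OF positive_part_approx_inner_has_derivative[of j \<nu> x]]
      by (simp add: has_field_derivative_def nn)
    have 2: "((\<lambda>t. ?Q (x + t *\<^sub>R \<nu>)) has_real_derivative (?G x \<bullet> \<nu>)) (at 0)"
      using comp[OF radial_profile_has_derivative[OF \<epsilon>, of x]]
      by (simp add: has_field_derivative_def mult.commute[of _ "_ \<bullet> _"])
    have "((\<lambda>t. ?p (x + t *\<^sub>R \<nu>) * (?Q (x + t *\<^sub>R \<nu>) * ?Q (x + t *\<^sub>R \<nu>))) has_real_derivative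
        ?p' x * (?Q (x + 0 *\<^sub>R \<nu>) * ?Q (x + 0 *\<^sub>R \<nu>))
        + ((?G x \<bullet> \<nu>) * ?Q (x + 0 *\<^sub>R \<nu>) + (?G x \<bullet> \<nu>) * ?Q (x + 0 *\<^sub>R \<nu>)) * ?p (x + 0 *\<^sub>R \<nu>)) (at 0)"
      by (rule DERIV_mult[OF 1 DERIV_mult[OF 2 2]])
    then show "((\<lambda>t. ?p (x + t *\<^sub>R \<nu>) * (?Q (x + t *\<^sub>R \<nu>))\<^sup>2) has_real_derivative d x) (at 0)"
      by (simp add: d_def power2_eq_square algebra_simps)
  qed (auto simp: zero d_def)
  moreover have "integrable lborel d"
    by (rule integrable_continuous_compact_support[OF cd compact_shell[of \<epsilon>]]) (simp add: d_def zero)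
  moreover have "integrable lborel (\<lambda>x. (norm (trial_grad \<nu> \<epsilon> j x))\<^sup>2)"
    by (rule integrable_continuous_compact_support[OF _ compact_shell[of \<epsilon>]])
       (auto simp: trial_grad_def zero intro!: continuous_intros continuous_trial[OF \<epsilon>, unfolded trial_grad_def[abs_def]])
  ultimately have "(\<integral>x. (norm (trial_grad \<nu> \<epsilon> j x))\<^sup>2 \<partial>lborel) = (\<integral>x. (norm (trial_grad \<nu> \<epsilon> j x))\<^sup>2 - d x \<partial>lborel)"
    by simp
  also have "(\<lambda>x. (norm (trial_grad \<nu> \<epsilon> j x))\<^sup>2 - d x) =
    (\<lambda>x. ((?p' x)\<^sup>2 - ?p' x) * (?Q x)\<^sup>2 + 2 * ?p x * (?p' x - 1) * ?Q x * (?G x \<bullet> \<nu>) + (?p x)\<^sup>2 * (norm (?G x))\<^sup>2)"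
  proof
    fix x
    have "(norm (trial_grad \<nu> \<epsilon> j x))\<^sup>2 = (?p' x * ?Q x) * (?p' x * ?Q x) + 2 * (?p' x * ?Q x) * (?p x * (?G x \<bullet> \<nu>))
        + ?p x * (?p x * (?G x \<bullet> ?G x))"
      unfolding power2_norm_eq_inner trial_grad_def inner_add_left inner_add_right inner_scaleR_left
        inner_scaleR_right nn inner_commute[of \<nu> "?G x"] by (simp add: algebra_simps)
    then show "(norm (trial_grad \<nu> \<epsilon> j x))\<^sup>2 - d x = ((?p' x)\<^sup>2 - ?p' x) * (?Q x)\<^sup>2
        + 2 * ?p x * (?p' x - 1) * ?Q x * (?G x \<bullet> \<nu>) + (?p x)\<^sup>2 * (norm (?G x))\<^sup>2"
      unfolding d_def power2_norm_eq_inner by (simp add: power2_eq_square algebra_simps)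
  qed
  finally show ?thesis .
qed

lemma trial_integrals_limits:
  fixes \<nu> :: "'a::euclidean_space"
  assumes \<epsilon>: "\<epsilon> > 0" and \<nu>: "norm \<nu> = 1"
  shows "(\<lambda>i. \<integral>x. (norm (trial_grad \<nu> \<epsilon> (real (Suc i)) x))\<^sup>2 \<partial>lborel) \<longlonglongrightarrow>
      (\<integral>x. (max 0 (x \<bullet> \<nu>))\<^sup>2 * (norm (radial_profile_grad \<epsilon> x))\<^sup>2 \<partial>lborel)" (is ?grad)
    and "(\<lambda>i. \<integral>x. (trial \<nu> \<epsilon> (real (Suc i)) x)\<^sup>2 / (norm x)\<^sup>2 \<partial>lborel) \<longlonglongrightarrow>
      (\<integral>x. (max 0 (x \<bullet> \<nu>))\<^sup>2 * (radial_profile \<epsilon> x)\<^sup>2 / (norm x)\<^sup>2 \<partial>lborel)" (is ?weight)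
proof -
  let ?p = "\<lambda>i x. positive_part_approx (real (Suc i)) (x \<bullet> \<nu>)"
  let ?p' = "\<lambda>i x. positive_part_approx' (real (Suc i)) (x \<bullet> \<nu>)"
  let ?Q = "radial_profile \<epsilon> :: 'a \<Rightarrow> real" and ?G = "radial_profile_grad \<epsilon> :: 'a \<Rightarrow> 'a"
  note cont = continuous_positive_part_approx continuous_radial_profile[OF \<epsilon>]
  have [measurable]: "?p i \<in> borel_measurable borel" "?p' i \<in> borel_measurable borel"
      "?Q \<in> borel_measurable borel" "?G \<in> borel_measurable borel" for i
    by (intro borel_measurable_continuous_onI cont)+
  have zero: "?Q x = 0" "?G x = 0" if "x \<notin> shell \<epsilon>" for x
    using radial_profile_off_shell[OF \<epsilon> that] by auto
  have pb: "\<bar>?p i x\<bar> \<le> \<bar>x \<bullet> \<nu>\<bar>" "0 \<le> ?p' i x" "?p' i x \<le> 2" for i x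
    using positive_part_approx_bounds[of "real (Suc i)" "x \<bullet> \<nu>"] by auto
  have p2: "(?p i x)\<^sup>2 \<le> (x \<bullet> \<nu>)\<^sup>2" for i x
    using pb(1)[of i x] by (simp add: abs_le_square_iff)
  note lims = positive_part_approx_limits
  show ?grad
    unfolding trial_gradient_square_integral[OF \<epsilon> \<nu>]
  proof (rule integral_dominated_convergence[where w="\<lambda>x. 2 * (?Q x)\<^sup>2 + 2 * \<bar>x \<bullet> \<nu>\<bar> * \<bar>?Q x\<bar> * \<bar>?G x \<bullet> \<nu>\<bar> + (x \<bullet> \<nu>)\<^sup>2 * (norm (?G x))\<^sup>2"])
    show "integrable lborel (\<lambda>x. 2 * (?Q x)\<^sup>2 + 2 * \<bar>x \<bullet> \<nu>\<bar> * \<bar>?Q x\<bar> * \<bar>?G x \<bullet> \<nu>\<bar> + (x \<bullet> \<nu>)\<^sup>2 * (norm (?G x))\<^sup>2)"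
      by (rule integrable_continuous_compact_support[OF _ compact_shell[of \<epsilon>]])
         (auto simp: zero intro!: continuous_intros cont)
    show "AE x in lborel. norm (((?p' i x)\<^sup>2 - ?p' i x) * (?Q x)\<^sup>2 + 2 * ?p i x * (?p' i x - 1) * ?Q x * (?G x \<bullet> \<nu>) + (?p i x)\<^sup>2 * (norm (?G x))\<^sup>2)
       \<le> 2 * (?Q x)\<^sup>2 + 2 * \<bar>x \<bullet> \<nu>\<bar> * \<bar>?Q x\<bar> * \<bar>?G x \<bullet> \<nu>\<bar> + (x \<bullet> \<nu>)\<^sup>2 * (norm (?G x))\<^sup>2" for i
    proof (intro always_eventually allI)
      fix x
      have "\<bar>(?p' i x)\<^sup>2 - ?p' i x\<bar> = \<bar>?p' i x\<bar> * \<bar>?p' i x - 1\<bar>"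
        by (simp add: power2_eq_square right_diff_distrib flip: abs_mult)
      also have "\<dots> \<le> 2 * 1"
        using pb(2,3)[of i x] by (intro mult_mono) auto
      finally have 1: "\<bar>((?p' i x)\<^sup>2 - ?p' i x) * (?Q x)\<^sup>2\<bar> \<le> 2 * (?Q x)\<^sup>2"
        unfolding abs_mult by (intro mult_mono) auto
      have "\<bar>2 * ?p i x * (?p' i x - 1) * ?Q x * (?G x \<bullet> \<nu>)\<bar> = 2 * (\<bar>?p i x\<bar> * \<bar>?p' i x - 1\<bar>) * \<bar>?Q x\<bar> * \<bar>?G x \<bullet> \<nu>\<bar>"
        by (simp add: abs_mult)
      also have "\<dots> \<le> 2 * (\<bar>x \<bullet> \<nu>\<bar> * 1) * \<bar>?Q x\<bar> * \<bar>?G x \<bullet> \<nu>\<bar>"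
        using pb[of i x] by (intro mult_right_mono mult_left_mono mult_mono) auto
      finally have 2: "\<bar>2 * ?p i x * (?p' i x - 1) * ?Q x * (?G x \<bullet> \<nu>)\<bar> \<le> 2 * \<bar>x \<bullet> \<nu>\<bar> * \<bar>?Q x\<bar> * \<bar>?G x \<bullet> \<nu>\<bar>" by simp
      have 3: "\<bar>(?p i x)\<^sup>2 * (norm (?G x))\<^sup>2\<bar> \<le> (x \<bullet> \<nu>)\<^sup>2 * (norm (?G x))\<^sup>2"
        using mult_right_mono[OF p2[of i x], of "(norm (?G x))\<^sup>2"] by simp
      show "norm (((?p' i x)\<^sup>2 - ?p' i x) * (?Q x)\<^sup>2 + 2 * ?p i x * (?p' i x - 1) * ?Q x * (?G x \<bullet> \<nu>) + (?p i x)\<^sup>2 * (norm (?G x))\<^sup>2)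
         \<le> 2 * (?Q x)\<^sup>2 + 2 * \<bar>x \<bullet> \<nu>\<bar> * \<bar>?Q x\<bar> * \<bar>?G x \<bullet> \<nu>\<bar> + (x \<bullet> \<nu>)\<^sup>2 * (norm (?G x))\<^sup>2"
        unfolding real_norm_def using 1 2 3 by linarith
    qed
    show "AE x in lborel. (\<lambda>i. ((?p' i x)\<^sup>2 - ?p' i x) * (?Q x)\<^sup>2 + 2 * ?p i x * (?p' i x - 1) * ?Q x * (?G x \<bullet> \<nu>) + (?p i x)\<^sup>2 * (norm (?G x))\<^sup>2)
       \<longlonglongrightarrow> (max 0 (x \<bullet> \<nu>))\<^sup>2 * (norm (?G x))\<^sup>2"
    proof (intro always_eventually allI)
      fix x
      let ?h = "if x \<bullet> \<nu> > 0 then 1 else 0 :: real"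
      have "(\<lambda>i. ((?p' i x)\<^sup>2 - ?p' i x) * (?Q x)\<^sup>2 + 2 * ?p i x * (?p' i x - 1) * ?Q x * (?G x \<bullet> \<nu>) + (?p i x)\<^sup>2 * (norm (?G x))\<^sup>2)
       \<longlonglongrightarrow> (?h\<^sup>2 - ?h) * (?Q x)\<^sup>2 + 2 * max 0 (x \<bullet> \<nu>) * (?h - 1) * ?Q x * (?G x \<bullet> \<nu>) + (max 0 (x \<bullet> \<nu>))\<^sup>2 * (norm (?G x))\<^sup>2"
        by (intro tendsto_intros lims)
      then show "(\<lambda>i. ((?p' i x)\<^sup>2 - ?p' i x) * (?Q x)\<^sup>2 + 2 * ?p i x * (?p' i x - 1) * ?Q x * (?G x \<bullet> \<nu>) + (?p i x)\<^sup>2 * (norm (?G x))\<^sup>2)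
       \<longlonglongrightarrow> (max 0 (x \<bullet> \<nu>))\<^sup>2 * (norm (?G x))\<^sup>2"
        by (cases "x \<bullet> \<nu> > 0") simp_all
    qed
  qed measurable
  show ?weight
    unfolding trial_def power_mult_distrib
  proof (rule integral_dominated_convergence[where w="\<lambda>x. (x \<bullet> \<nu>)\<^sup>2 * (?Q x)\<^sup>2 / (norm x)\<^sup>2"])
    have "continuous_on (- {0}) (\<lambda>x. (x \<bullet> \<nu>)\<^sup>2 * (?Q x)\<^sup>2 / (norm x)\<^sup>2)"
      by (intro continuous_intros continuous_on_subset[OF cont(3)]) auto
    then have "continuous_on UNIV (\<lambda>x. (x \<bullet> \<nu>)\<^sup>2 * (?Q x)\<^sup>2 / (norm x)\<^sup>2)"
      by (rule continuous_on_zero_off_compact[OF _ _ compact_shell[of \<epsilon>]])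
         (use zero zero_not_in_shell in auto)
    then show "integrable lborel (\<lambda>x. (x \<bullet> \<nu>)\<^sup>2 * (?Q x)\<^sup>2 / (norm x)\<^sup>2)"
      by (rule integrable_continuous_compact_support[OF _ compact_shell[of \<epsilon>]]) (simp add: zero)
    show "AE x in lborel. norm ((?p i x)\<^sup>2 * (?Q x)\<^sup>2 / (norm x)\<^sup>2) \<le> (x \<bullet> \<nu>)\<^sup>2 * (?Q x)\<^sup>2 / (norm x)\<^sup>2" for i
    proof (intro always_eventually allI)
      fix x
      have "(?p i x)\<^sup>2 * (?Q x)\<^sup>2 / (norm x)\<^sup>2 \<le> (x \<bullet> \<nu>)\<^sup>2 * (?Q x)\<^sup>2 / (norm x)\<^sup>2"
        by (intro divide_right_mono mult_right_mono p2) auto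
      then show "norm ((?p i x)\<^sup>2 * (?Q x)\<^sup>2 / (norm x)\<^sup>2) \<le> (x \<bullet> \<nu>)\<^sup>2 * (?Q x)\<^sup>2 / (norm x)\<^sup>2"
        by simp
    qed
    show "AE x in lborel. (\<lambda>i. (?p i x)\<^sup>2 * (?Q x)\<^sup>2 / (norm x)\<^sup>2) \<longlonglongrightarrow> (max 0 (x \<bullet> \<nu>))\<^sup>2 * (?Q x)\<^sup>2 / (norm x)\<^sup>2"
    proof (intro always_eventually allI)
      fix x
      have "(\<lambda>i. (?p i x)\<^sup>2 * ((?Q x)\<^sup>2 / (norm x)\<^sup>2)) \<longlonglongrightarrow> (max 0 (x \<bullet> \<nu>))\<^sup>2 * ((?Q x)\<^sup>2 / (norm x)\<^sup>2)"
        by (intro tendsto_intros lims)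
      then show "(\<lambda>i. (?p i x)\<^sup>2 * (?Q x)\<^sup>2 / (norm x)\<^sup>2) \<longlonglongrightarrow> (max 0 (x \<bullet> \<nu>))\<^sup>2 * (?Q x)\<^sup>2 / (norm x)\<^sup>2"
        by simp
    qed
  qed measurable
qed

text \<open>
  Away from the origin the profile is a product of compositions with \<open>ln\<close>, powers and the
  flat function; on the unit ball it is 0.
\<close>

lemma trial_smooth:
  fixes \<nu> :: "real ^ 'n::finite"
  assumes "\<epsilon> > 0"
  shows "C_k k (trial \<nu> \<epsilon> j)"
proof -
  let ?U = "- {0} :: (real ^ 'n) set" and ?n = "real DIM(real ^ 'n)"
  let ?S = "insert ln (range (\<lambda>(c::real, a::real). \<lambda>s::real. c * s powr a))"
  have U: "open ?U" by auto
  have im: "(\<lambda>x. x \<bullet> x) ` ?U \<subseteq> {0<..}" by auto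
  have L: "C_k_on ?U k (\<lambda>x. ln (x \<bullet> x))" for k
    by (rule C_k_on_compose[OF U derivative_closed_ln_powr _ C_k_on_inner_self[OF U] im]) simp
  have pow: "C_k_on ?U k (\<lambda>x. 1 * (x \<bullet> x) powr (- ?n / 4))" for k
    by (rule C_k_on_compose[OF U derivative_closed_ln_powr _ C_k_on_inner_self[OF U] im, of "\<lambda>s. 1 * s powr (- ?n / 4)"])
       (auto intro!: image_eqI[of _ _ "(1, - ?n / 4)"])
  have affine: "C_k_on V k (\<lambda>x. c * f x + b)" if "open V" "C_k_on V k f" for c b k f and V :: "(real ^ 'n) set"
    using that by (intro C_k_on_add C_k_on_mult C_k_on_const)
  have flat: "C_k_on V k (\<lambda>x. flat0 (f x))" if "open V" "\<And>k. C_k_on V k f" for f k and V :: "(real ^ 'n) set"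
    by (rule C_k_on_compose[OF that(1) derivative_closed_flat _ that(2)]) auto
  have "C_k_on ?U k (\<lambda>x. 1 * (x \<bullet> x) powr (- ?n / 4) *
      (flat0 ((\<epsilon> / 2) * ln (x \<bullet> x) + 0) * flat0 ((- \<epsilon> / 2) * ln (x \<bullet> x) + 3)))"
    by (intro C_k_on_mult U pow flat affine L)
  then have Q1: "C_k_on ?U k (radial_profile \<epsilon>)"
    by (rule C_k_on_cong[OF U]) (simp add: radial_profile_def bump_def log_norm_def)
  have Q2: "C_k_on (ball 0 1) k (radial_profile \<epsilon> :: real ^ 'n \<Rightarrow> real)"
    by (rule C_k_on_cong[OF open_ball C_k_on_const[of _ _ 0]])
       (rule radial_profile_off_shell(1)[OF assms, symmetric], simp add: shell_def)
  have "C_k_on (?U \<union> ball 0 1) k (radial_profile \<epsilon>)"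
    by (rule C_k_on_Un[OF U open_ball Q1 Q2])
  moreover have "?U \<union> ball 0 1 = UNIV" by auto
  ultimately have Q: "C_k_on UNIV k (radial_profile \<epsilon> :: real ^ 'n \<Rightarrow> real)" by simp
  have "C_k_on UNIV k (\<lambda>x. (x \<bullet> \<nu>) * flat0 (j * (x \<bullet> \<nu>) + (- 1)) * radial_profile \<epsilon> x)"
    by (intro C_k_on_mult flat affine C_k_on_inner Q open_UNIV)
  then show ?thesis
    by (simp add: C_k_on_UNIV trial_def[abs_def] positive_part_approx_def)
qed

lemma trial_support:
  fixes \<nu> :: "'a::euclidean_space"
  assumes "\<epsilon> > 0" "j > 0"
  shows "closure {x. trial \<nu> \<epsilon> j x \<noteq> 0} \<subseteq> shell \<epsilon> \<inter> {x. 1 / j \<le> x \<bullet> \<nu>}"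
proof (rule closure_minimal)
  show "{x. trial \<nu> \<epsilon> j x \<noteq> 0} \<subseteq> shell \<epsilon> \<inter> {x. 1 / j \<le> x \<bullet> \<nu>}"
  proof
    fix x assume "x \<in> {x. trial \<nu> \<epsilon> j x \<noteq> 0}"
    then have "radial_profile \<epsilon> x \<noteq> 0" "positive_part_approx j (x \<bullet> \<nu>) \<noteq> 0"
      by (auto simp: trial_def)
    then show "x \<in> shell \<epsilon> \<inter> {x. 1 / j \<le> x \<bullet> \<nu>}"
      using radial_profile_off_shell(1)[OF assms(1), of x] positive_part_approx_support(1)[OF assms(2), of "x \<bullet> \<nu>"]
      by (auto simp: not_le intro: ccontr)
  qed
  show "closed (shell \<epsilon> \<inter> {x. 1 / j \<le> x \<bullet> \<nu>})"
    by (intro closed_Int compact_imp_closed compact_shell closed_Collect_le continuous_intros)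
qed

text \<open>
  The support of the trial function is a compact subset of \<open>x \<bullet> c > 0\<close>. A point \<open>x / \<mu>\<close> lies in the ball of
  radius \<open>|c|\<close> about \<open>c\<close> as soon as \<open>|x|\<^sup>2 < 2 \<mu> (x \<bullet> c)\<close>, so a large factor \<open>\<mu>\<close> moves the
  whole support into the ball.
\<close>

lemma rescaled_trial_is_test_function:
  fixes c :: "real ^ 'n::finite"
  assumes r: "norm c = r" "r > 0" and sub: "ball c r \<subseteq> \<Omega>" and \<epsilon>: "\<epsilon> > 0" and j: "j > 0"
  obtains \<mu> where "\<mu> > 0" "(\<lambda>x. trial ((1 / r) *\<^sub>R c) \<epsilon> j (\<mu> *\<^sub>R x)) \<in> test_functions \<Omega>"
proof -
  let ?\<nu> = "(1 / r) *\<^sub>R c"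
  let ?u = "trial ?\<nu> \<epsilon> j"
  define R where "R = exp (3 / \<epsilon>)"
  \<comment> \<open>On the support, \<open>|x| \<le> R\<close> and \<open>x \<bullet> c \<ge> r / j\<close>, so \<open>\<mu> (x \<bullet> c) \<ge> R\<^sup>2\<close>.\<close>
  define \<mu> where "\<mu> = j * R\<^sup>2 / r"
  have R: "R > 0" by (simp add: R_def)
  have \<mu>: "\<mu> > 0" using r j R by (simp add: \<mu>_def)
  let ?v = "\<lambda>x. ?u (\<mu> *\<^sub>R x)"
  let ?K = "(\<lambda>x. (1 / \<mu>) *\<^sub>R x) ` (shell \<epsilon> \<inter> {x. 1 / j \<le> x \<bullet> ?\<nu>})"
  have "compact (shell \<epsilon> \<inter> {x. 1 / j \<le> x \<bullet> ?\<nu>})"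
    by (intro compact_Int_closed compact_shell closed_Collect_le continuous_intros)
  then have K: "compact ?K" by (intro compact_continuous_image continuous_intros)
  have "x \<in> ?K" if "?v x \<noteq> 0" for x
  proof -
    have "\<mu> *\<^sub>R x \<in> shell \<epsilon> \<inter> {x. 1 / j \<le> x \<bullet> ?\<nu>}"
      using trial_support[OF \<epsilon> j, of ?\<nu>] closure_subset[of "{x. ?u x \<noteq> 0}"] that by blast
    then show ?thesis using \<mu> by (intro image_eqI[of _ _ "\<mu> *\<^sub>R x"]) auto
  qed
  then have clK: "closure {x. ?v x \<noteq> 0} \<subseteq> ?K"
    by (intro closure_minimal compact_imp_closed K) auto
  have "?K \<subseteq> ball c r"
  proof
    fix y assume "y \<in> ?K"
    then obtain x where x: "x \<in> shell \<epsilon>" "1 / j \<le> x \<bullet> ?\<nu>" and y: "y = (1 / \<mu>) *\<^sub>R x" by auto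
    have "(norm x)\<^sup>2 \<le> R\<^sup>2" using x(1) by (intro power_mono) (auto simp: shell_def R_def)
    moreover have "r / j \<le> x \<bullet> c"
      using x(2) r(2) j by (simp add: field_simps)
    ultimately have "(norm x)\<^sup>2 < \<mu> * (2 * (x \<bullet> c))"
    proof -
      have "R\<^sup>2 = \<mu> * (r / j)" using r j by (simp add: \<mu>_def)
      also have "\<dots> \<le> \<mu> * (x \<bullet> c)" using \<mu> \<open>r / j \<le> x \<bullet> c\<close> by (intro mult_left_mono) auto
      finally have "R\<^sup>2 \<le> \<mu> * (x \<bullet> c)" .
      moreover have "R\<^sup>2 > 0" using R by simp
      ultimately show ?thesis using \<open>(norm x)\<^sup>2 \<le> R\<^sup>2\<close> by linarith
    qed
    then have "(1 / \<mu>) * (1 / \<mu>) * (norm x)\<^sup>2 < (1 / \<mu>) * (1 / \<mu>) * (\<mu> * (2 * (x \<bullet> c)))"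
      using \<mu> by (intro mult_strict_left_mono) auto
    then have "y \<bullet> y < 2 * (y \<bullet> c)"
      using \<mu> by (simp add: y power2_norm_eq_inner)
    then have "(c - y) \<bullet> (c - y) < c \<bullet> c"
      by (simp add: inner_diff_left inner_diff_right inner_commute[of c y])
    then have "(norm (c - y))\<^sup>2 < r\<^sup>2" using r by (simp add: power2_norm_eq_inner flip: r(1))
    then show "y \<in> ball c r" using r by (simp add: dist_norm power2_less_imp_less)
  qed
  with clK sub have "closure {x. ?v x \<noteq> 0} \<subseteq> \<Omega>" by blast
  moreover have "compact (closure {x. ?v x \<noteq> 0})"
    using clK K compact_closure bounded_subset compact_imp_bounded closure_subset by (meson order_trans)
  moreover have "\<forall>k. C_k k ?v" using C_k_scaling[OF trial_smooth[OF \<epsilon>]] by blast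
  ultimately show thesis using that[OF \<mu>] by (simp add: test_functions_def)
qed

section \<open>Sharpness of the constant and the theorem\<close>

text \<open>
  Both integrals of \<open>u (\<mu> x)\<close> are \<open>\<mu>\<^bsup>2-n\<^esup>\<close> times those of \<open>u\<close>, so a trial function that violates the
  inequality in the half space still violates it after the contraction into \<open>\<Omega>\<close>.
\<close>

lemma hardy_constant_sharp:
  fixes \<Omega> :: "(real ^ 'n::finite) set"
  assumes "interior_ball_condition \<Omega> 0" and C: "C > (real CARD('n))\<^sup>2 / 4"
  shows "\<not> hardy_inequality \<Omega> C"
proof
  assume hardy: "hardy_inequality \<Omega> C"
  obtain c r where r: "r > 0" and sub: "ball c r \<subseteq> \<Omega>" and "0 \<in> frontier (ball c r)"
    using assms(1) by (auto simp: interior_ball_condition_def)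
  then have nc: "norm c = r" by (simp add: frontier_ball dist_norm)
  let ?\<nu> = "(1 / r) *\<^sub>R c"
  have \<nu>: "norm ?\<nu> = 1" using nc r by simp
  obtain \<epsilon> where \<epsilon>: "\<epsilon> > 0" and less:
    "(\<integral>x. (max 0 (x \<bullet> ?\<nu>))\<^sup>2 * (norm (radial_profile_grad \<epsilon> x))\<^sup>2 \<partial>lborel)
       < C * (\<integral>x. (max 0 (x \<bullet> ?\<nu>))\<^sup>2 * (radial_profile \<epsilon> x)\<^sup>2 / (norm x)\<^sup>2 \<partial>lborel)"
    using almost_critical_profile[OF \<nu>, of C] C by auto
  have "eventually (\<lambda>i. (\<integral>x. (norm (trial_grad ?\<nu> \<epsilon> (real (Suc i)) x))\<^sup>2 \<partial>lborel)
      < C * (\<integral>x. (trial ?\<nu> \<epsilon> (real (Suc i)) x)\<^sup>2 / (norm x)\<^sup>2 \<partial>lborel)) sequentially"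
    using order_tendstoD(2)[OF tendsto_diff[OF trial_integrals_limits(1)[OF \<epsilon> \<nu>]
        tendsto_mult[OF tendsto_const[of C] trial_integrals_limits(2)[OF \<epsilon> \<nu>]]], of 0] less
    by simp
  then obtain i where i: "(\<integral>x. (norm (trial_grad ?\<nu> \<epsilon> (real (Suc i)) x))\<^sup>2 \<partial>lborel)
      < C * (\<integral>x. (trial ?\<nu> \<epsilon> (real (Suc i)) x)\<^sup>2 / (norm x)\<^sup>2 \<partial>lborel)"
    by (meson eventually_happens' sequentially_bot)
  let ?j = "real (Suc i)"
  let ?u = "trial ?\<nu> \<epsilon> ?j" and ?Du = "trial_grad ?\<nu> \<epsilon> ?j"
  obtain \<mu> where \<mu>: "\<mu> > 0" and test: "(\<lambda>x. ?u (\<mu> *\<^sub>R x)) \<in> test_functions \<Omega>"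
    using rescaled_trial_is_test_function[OF nc r sub \<epsilon>, of ?j] by auto
  let ?v = "\<lambda>x. ?u (\<mu> *\<^sub>R x)"
  have grad: "gradient ?v x = \<mu> *\<^sub>R ?Du (\<mu> *\<^sub>R x)" for x
  proof (rule gradient_eqI)
    have "((\<lambda>x. \<mu> *\<^sub>R x) has_derivative (\<lambda>v. \<mu> *\<^sub>R v)) (at x)"
      by (auto intro!: derivative_eq_intros)
    from has_derivative_compose[OF this trial_has_derivative[OF \<epsilon>]]
    show "(?v has_derivative (\<lambda>h. (\<mu> *\<^sub>R ?Du (\<mu> *\<^sub>R x)) \<bullet> h)) (at x)" by simp
  qed
  have m: "(\<lambda>x. (norm (?Du x))\<^sup>2) \<in> borel_measurable borel" "(\<lambda>x. (?u x)\<^sup>2 / (norm x)\<^sup>2) \<in> borel_measurable borel"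
    using borel_measurable_continuous_onI[OF continuous_trial(1)[OF \<epsilon>, of ?\<nu> ?j]]
      borel_measurable_continuous_onI[OF continuous_trial(2)[OF \<epsilon>, of ?\<nu> ?j]] by measurable
  let ?d = "DIM(real ^ 'n)"
  have 1: "(\<integral>x. (norm (gradient ?v x))\<^sup>2 \<partial>lborel) = \<mu>\<^sup>2 * (\<integral>x. (norm (?Du (\<mu> *\<^sub>R x)))\<^sup>2 \<partial>lborel)"
    unfolding grad by (simp add: power_mult_distrib)
  have "(?v x)\<^sup>2 / (norm x)\<^sup>2 = \<mu>\<^sup>2 * ((?u (\<mu> *\<^sub>R x))\<^sup>2 / (norm (\<mu> *\<^sub>R x))\<^sup>2)" for x
    using \<mu> by (simp add: power_mult_distrib)
  then have 2: "(\<integral>x. (?v x)\<^sup>2 / (norm x)\<^sup>2 \<partial>lborel) = \<mu>\<^sup>2 * (\<integral>x. (?u (\<mu> *\<^sub>R x))\<^sup>2 / (norm (\<mu> *\<^sub>R x))\<^sup>2 \<partial>lborel)"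
    by (simp only: integral_mult_right_zero)
  have "C * (\<integral>x. (?v x)\<^sup>2 / (norm x)\<^sup>2 \<partial>lborel) \<le> (\<integral>x. (norm (gradient ?v x))\<^sup>2 \<partial>lborel)"
    using bspec[OF hardy[unfolded hardy_inequality_def] test] unfolding test_function_integrals[OF test] .
  then have "\<mu>\<^sup>2 * (C * (\<integral>x. (?u (\<mu> *\<^sub>R x))\<^sup>2 / (norm (\<mu> *\<^sub>R x))\<^sup>2 \<partial>lborel)) \<le> \<mu>\<^sup>2 * (\<integral>x. (norm (?Du (\<mu> *\<^sub>R x)))\<^sup>2 \<partial>lborel)"
    unfolding 1 2 by (simp only: mult.left_commute)
  then have "C * (\<integral>x. (?u (\<mu> *\<^sub>R x))\<^sup>2 / (norm (\<mu> *\<^sub>R x))\<^sup>2 \<partial>lborel) \<le> (\<integral>x. (norm (?Du (\<mu> *\<^sub>R x)))\<^sup>2 \<partial>lborel)"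
    using \<mu> by (simp only: mult_le_cancel_left_pos zero_less_power)
  then have "\<mu> ^ ?d * (C * (\<integral>x. (?u (\<mu> *\<^sub>R x))\<^sup>2 / (norm (\<mu> *\<^sub>R x))\<^sup>2 \<partial>lborel)) \<le> \<mu> ^ ?d * (\<integral>x. (norm (?Du (\<mu> *\<^sub>R x)))\<^sup>2 \<partial>lborel)"
    using \<mu> by (intro mult_left_mono) auto
  then have "C * (\<integral>x. (?u x)\<^sup>2 / (norm x)\<^sup>2 \<partial>lborel) \<le> (\<integral>x. (norm (?Du x))\<^sup>2 \<partial>lborel)"
    unfolding integral_dilation_lborel[OF m(1) \<mu>, symmetric] integral_dilation_lborel[OF m(2) \<mu>, symmetric]
    by (simp only: mult.left_commute)
  with i show False by linarith
qed

theorem theorem1: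
  assumes "CARD('n::finite) \<ge> 2"
  shows "\<exists>\<tau>>0. \<forall>(k::'n) (\<Omega>::(real ^ 'n) set) (\<rho>::real).
           domain \<Omega> \<longrightarrow> bounded \<Omega> \<longrightarrow> 0 \<in> frontier \<Omega> \<longrightarrow>
           \<rho> > 0 \<longrightarrow> ball (- \<rho> *\<^sub>R axis k 1) \<rho> \<subseteq> - closure \<Omega> \<longrightarrow>
           \<rho> \<ge> (SUP x\<in>\<Omega>. norm x) / \<tau> \<longrightarrow>
             hardy_inequality \<Omega> ((real CARD('n))\<^sup>2 / 4) \<and>
             (interior_ball_condition \<Omega> 0 \<longrightarrow>
                (\<forall>C > (real CARD('n))\<^sup>2 / 4. \<not> hardy_inequality \<Omega> C))"
proof -
  let ?n = "real CARD('n)"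
  have pos: "?n\<^sup>2 + ?n + 1 > 0" by (simp add: add_nonneg_pos)
  show ?thesis
  proof (intro exI[of _ "1 / (?n\<^sup>2 + ?n + 1)"] conjI allI impI)
    fix k :: 'n and \<Omega> :: "(real ^ 'n) set" and \<rho> :: real
    assume "domain \<Omega>" "bounded \<Omega>" "0 \<in> frontier \<Omega>" "\<rho> > 0"
      "ball (- \<rho> *\<^sub>R axis k 1) \<rho> \<subseteq> - closure \<Omega>" "(SUP x\<in>\<Omega>. norm x) / (1 / (?n\<^sup>2 + ?n + 1)) \<le> \<rho>"
    then show "hardy_inequality \<Omega> (?n\<^sup>2 / 4)"
      by (intro hardy_inequality_exterior_ball[of \<Omega> "axis k 1" \<rho>])
         (auto simp: domain_def frontier_def interior_open)
  next
    fix \<Omega> :: "(real ^ 'n) set" and C :: real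
    assume "interior_ball_condition \<Omega> 0" "C > ?n\<^sup>2 / 4"
    then show "\<not> hardy_inequality \<Omega> C" by (rule hardy_constant_sharp)
  qed (use pos in simp)
qed

end
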